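(* Let $3\le p\le n-1$, let $W\subset\mathbb{R}^N$ be a smooth compact semi-algebraic embedded submanifold without boundary, of dimension $n-1$, and let $F=(f_1,\ldots,f_p):\mathbb{R}^N\to\mathbb{R}^p$ be a $C^2$ semi-algebraic map satisfying Conditions (a) and (b). Let $G=(f_1,\ldots,f_{p-1}):\mathbb{R}^N\to\mathbb{R}^{p-1}$. Let $M_F$ be the fiber of the locally trivial fibration $\bar F:W\setminus V_W(F)\to S^{p-1}$ and $M_G$ the fiber of the locally trivial fibration $\bar G:W\setminus V_W(G)\to S^{p-2}$. Then $M_G$ is homotopy equivalent to $M_F$.
   Context: For a $C^2$ semi-algebraic map $H:\mathbb{R}^N\to\mathbb{R}^q$ with $q\ge 2$: $V(H)=H^{-1}(0)$, $V_W(H)=V(H)\cap W$, $\bar H=H/\|H\|:\mathbb{R}^N\setminus V(H)\to S^{q-1}$ (Euclidean norm); $\Sigma_H^W\subset W$ is the set of critical points of $H_{|W}$ (differential of rank $<q$), and $\Sigma_{\bar H}^W\subset W\setminus V_W(H)$ is the set of critical points of $\bar H_{|W\setminus V_W(H)}$ (differential of rank $<q-1$). $H$ satisfies Condition (a) if $\overline{\Sigma_H^W\setminus V_W(H)}\cap V_W(H)=\emptyset$ and Condition (b) if $\Sigma_{\bar H}^W=\emptyset$. When $F$ satisfies Conditions (a) and (b), so does $G$, and both $\bar F$ on $W\setminus V_W(F)$ and $\bar G$ on $W\setminus V_W(G)$ are $C^2$ locally trivial fibrations (the fibre possibly empty); since the bases are connected, the fiber is well defined up to diffeomorphism. One may take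 $M_F=\{f_1>0,\ f_2=\cdots=f_p=0\}\cap W$ and $M_G=\{f_1>0,\ f_2=\cdots=f_{p-1}=0\}\cap W$. *)

theory Defs
  imports "HOL-Analysis.Analysis"
begin

subsection \<open>Semi-algebraic sets and maps\<close>

text \<open>The smallest Boolean algebra of subsets containing all sets \<open>{P > 0}\<close> with \<open>P\<close> a real
  polynomial; closure under intersection and the sets \<open>{P = 0}\<close> come for free.\<close>

inductive semialgebraic :: "'a::euclidean_space set \<Rightarrow> bool" where
  positivity: "real_polynomial_function P \<Longrightarrow> semialgebraic {x. P x > 0}"
| union: "semialgebraic A \<Longrightarrow> semialgebraic B \<Longrightarrow> semialgebraic (A \<union> B)"
| complement: "semialgebraic A \<Longrightarrow> semialgebraic (- A)"

definition semialgebraic_map :: "('a::euclidean_space \<Rightarrow> 'b::euclidean_space) \<Rightarrow> bool" where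
  "semialgebraic_map H \<longleftrightarrow> semialgebraic {(x, y). y = H x}"

subsection \<open>Maps of class \<open>C\<^sup>k\<close> and smooth submanifolds\<close>

text \<open>Only meant for open \<open>S\<close>. In finite dimension \<open>f\<close> is \<open>C\<^sup>k\<^sup>+\<^sup>1\<close> iff it is differentiable and
  each directional derivative \<open>x \<mapsto> Df(x)v\<close> is \<open>C\<^sup>k\<close>.\<close>

primrec Ck_on :: "nat \<Rightarrow> 'a::euclidean_space set \<Rightarrow> ('a \<Rightarrow> 'b::euclidean_space) \<Rightarrow> bool" where
  "Ck_on 0 S f \<longleftrightarrow> continuous_on S f"
| "Ck_on (Suc k) S f \<longleftrightarrow>
     (\<exists>f'. (\<forall>x\<in>S. (f has_derivative f' x) (at x)) \<and> (\<forall>v. Ck_on k S (\<lambda>x. f' x v)))"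

definition Cinf_on :: "'a::euclidean_space set \<Rightarrow> ('a \<Rightarrow> 'b::euclidean_space) \<Rightarrow> bool" where
  "Cinf_on S f \<longleftrightarrow> (\<forall>k. Ck_on k S f)"

text \<open>Embedded \<open>d\<close>-dimensional submanifold without boundary: around each point of \<open>W\<close> a smooth
  diffeomorphism of open subsets of the ambient space straightens \<open>W\<close> to a \<open>d\<close>-dimensional
  linear subspace. The empty set qualifies, for every \<open>d\<close>.\<close>

definition smooth_submanifold :: "nat \<Rightarrow> 'a::euclidean_space set \<Rightarrow> bool" where
  "smooth_submanifold d W \<longleftrightarrow>
     (\<forall>x\<in>W. \<exists>U V \<phi> \<psi> (L :: 'a set).
        open U \<and> x \<in> U \<and> open V \<and> homeomorphism U V \<phi> \<psi> \<and> Cinf_on U \<phi> \<and> Cinf_on V \<psi> \<and>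
        subspace L \<and> dim L = d \<and> \<phi> ` (W \<inter> U) = L \<inter> V)"

text \<open>Velocities at \<open>x\<close> of smooth curves in \<open>M\<close>.\<close>

definition tangent_space :: "'a::euclidean_space set \<Rightarrow> 'a \<Rightarrow> 'a set" where
  "tangent_space M x =
     {v. \<exists>\<gamma> \<epsilon>. \<epsilon> > 0 \<and> Cinf_on {-\<epsilon><..<\<epsilon>} \<gamma> \<and> \<gamma> ` {-\<epsilon><..<\<epsilon>} \<subseteq> M \<and> \<gamma> 0 = x \<and>
             (\<gamma> has_vector_derivative v) (at 0)}"

subsection \<open>Critical points and Conditions (a) and (b)\<close>

text \<open>Points of the submanifold \<open>M\<close> at which the differential of \<open>H\<close> restricted to \<open>M\<close> has rank
  less than \<open>r\<close>; \<open>H\<close> is assumed to be differentiable in an ambient neighbourhood of \<open>M\<close>. The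
  required rank \<open>r\<close> is the dimension of the target manifold, which for sphere-valued maps is one
  less than \<open>DIM('b)\<close>.\<close>

definition critical_points ::
    "nat \<Rightarrow> 'a::euclidean_space set \<Rightarrow> ('a \<Rightarrow> 'b::euclidean_space) \<Rightarrow> 'a set" where
  "critical_points r M H =
     {x\<in>M. dim (frechet_derivative H (at x) ` tangent_space M x) < r}"

definition zeros_in :: "'a::euclidean_space set \<Rightarrow> ('a \<Rightarrow> 'b::euclidean_space) \<Rightarrow> 'a set" where
  "zeros_in W H = {x\<in>W. H x = 0}"

text \<open>The map \<open>H / \<parallel>H\<parallel>\<close> to the unit sphere; only meaningful where \<open>H\<close> does not vanish.\<close>

definition normalized :: "('a::euclidean_space \<Rightarrow> 'b::euclidean_space) \<Rightarrow> 'a \<Rightarrow> 'b" where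
  "normalized H x = H x /\<^sub>R norm (H x)"

definition condition_a :: "'a::euclidean_space set \<Rightarrow> ('a \<Rightarrow> 'b::euclidean_space) \<Rightarrow> bool" where
  "condition_a W H \<longleftrightarrow>
     closure (critical_points DIM('b) W H - zeros_in W H) \<inter> zeros_in W H = {}"

definition condition_b :: "'a::euclidean_space set \<Rightarrow> ('a \<Rightarrow> 'b::euclidean_space) \<Rightarrow> bool" where
  "condition_b W H \<longleftrightarrow>
     critical_points (DIM('b) - 1) (W - zeros_in W H) (normalized H) = {}"

definition normalized_fibre ::
    "'a::euclidean_space set \<Rightarrow> ('a \<Rightarrow> 'b::euclidean_space) \<Rightarrow> 'b \<Rightarrow> 'a set" where
  "normalized_fibre W H y = {x \<in> W - zeros_in W H. normalized H x = y}"

end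

theory Submission
  imports Defs
begin

text \<open>
  Let \<open>e\<close> be the coordinate vector of the coordinate that \<open>G\<close> omits, and embed \<open>z\<close> as a unit vector
  \<open>u\<close> orthogonal to \<open>e\<close>. A point lies in the fibre of \<open>G / \<parallel>G\<parallel>\<close> over \<open>z\<close> exactly if \<open>F\<close> takes it to an
  open half plane \<open>{\<alpha> u + \<beta> e | \<alpha> > 0}\<close>, that is, if \<open>F / \<parallel>F\<parallel>\<close> takes it to an open half circle of
  the unit sphere. So the theorem says that the part of \<open>W\<close> above an open half circle can be deformed
  into one fibre of \<open>F / \<parallel>F\<parallel>\<close>. It also shows that fibres over any two points that are not antipodal are
  homotopy equivalent, because some open half circle contains both; as the sphere has dimension at least
  one, an intermediate point deals with antipodal points.

  The deformation comes from maps \<open>\<Phi> a\<close> of \<open>W - V(F)\<close> that turn \<open>F / \<parallel>F\<parallel>\<close> by the angle \<open>a\<close> wherever it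
  takes values in a given plane (\<open>rotation_flow\<close>). They are flows of a tangent field \<open>X\<close> of \<open>W\<close> with
  \<open>dF(X) = A F + l F\<close>, where \<open>A\<close> is the skew matrix generating the rotation and \<open>l\<close> is a scalar function:
  the radial term \<open>l F\<close> does not affect \<open>F / \<parallel>F\<parallel>\<close>. Since \<open>W - V(F)\<close> is not compact, a flow line must be
  kept from running into \<open>V(F)\<close>. This is what Condition (a) is for: near \<open>V(F)\<close>, \<open>F\<close> itself is a
  submersion off \<open>V(F)\<close>, so that \<open>l = 0\<close> can be achieved there, and then \<open>\<parallel>F\<parallel>\<close> is constant along flow lines near
  \<open>V(F)\<close>. Condition (b) provides \<open>X\<close> in the remaining region (\<open>lifted_vector_field\<close>).

  Only Lipschitz regularity of \<open>X\<close> is ever used. Instead of orthogonal projections to the tangent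
  spaces, finitely many Lipschitz fields \<open>Y j\<close> that span every tangent space (\<open>lipschitz_frame\<close>)
  give a formula for \<open>X\<close> in terms of the solution of a positive definite linear system. Its
  flow is obtained in the ambient space from an arbitrary Lipschitz extension of \<open>X\<close>; it stays in \<open>W\<close>
  because \<open>X\<close> is tangent to \<open>W\<close> (\<open>lipschitz_ode_solution_in\<close>).
\<close>

section \<open>Lipschitz differential equations\<close>

text \<open>Picard iteration, made contracting on the whole interval at once by measuring a curve \<open>\<gamma>\<close> through the
  rescaled deviation \<open>y(t) = exp(-2Mt) (\<gamma>(t) - x0)\<close>: the weight turns the Lipschitz constant \<open>M\<close> of the
  field into the contraction factor \<open>1/2\<close>.\<close>

lemma lipschitz_ode_solution:
  fixes X :: "'a::euclidean_space \<Rightarrow> 'a"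
  assumes "L-lipschitz_on UNIV X"
  obtains \<gamma> where "\<gamma> 0 = x0"
    and "\<And>t. t \<in> {0..1} \<Longrightarrow> (\<gamma> has_vector_derivative X (\<gamma> t)) (at t within {0..1})"
proof -
  \<comment> \<open>\<open>M > 0\<close> even if \<open>L = 0\<close>; the weight needs a positive
    rate.\<close>
  define M where "M = L + 1"
  have M: "M > 0" "M-lipschitz_on UNIV X"
    using lipschitz_on_nonneg[OF assms] lipschitz_on_mono[OF assms] by (auto simp: M_def)
  have contX: "continuous_on S X" for S
    using lipschitz_on_continuous_on[OF assms] continuous_on_subset by blast
  \<comment> \<open>\<open>c y\<close> is the curve encoded by \<open>y\<close>, and \<open>I
    y\<close> encodes its Picard iterate.\<close>
  define c where "c y s = x0 + exp (2 * M * s) *\<^sub>R y s" for y :: "real \<Rightarrow> 'a" and s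
  define I where "I y t = exp (- 2 * M * t) *\<^sub>R integral {0..t} (\<lambda>s. X (c y s))"
    for y :: "real \<Rightarrow> 'a" and t
  have contc: "continuous_on S (\<lambda>s. X (c (apply_bcontfun y) s))" for y S
    unfolding c_def
    by (intro continuous_on_compose2[OF contX[of UNIV]] continuous_intros) auto
  have "continuous_on {0..1} (I (apply_bcontfun y))" for y
    unfolding I_def
    by (intro continuous_intros indefinite_integral_continuous_1 integrable_continuous_real contc)
  then have "\<exists>g :: real \<Rightarrow>\<^sub>C 'a. (\<forall>x\<in>{0..1}. g x = I y x) \<and> (\<forall>x. g x = I y (clamp 0 1 x))"
    for y :: "real \<Rightarrow>\<^sub>C 'a"
    using continuous_on_cbox_bcontfunE[of 0 "1::real" "I y"] by (metis cbox_interval)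
  then obtain P :: "(real \<Rightarrow>\<^sub>C 'a) \<Rightarrow> (real \<Rightarrow>\<^sub>C 'a)"
    where P: "\<And>y x. x \<in> {0..1} \<Longrightarrow> P y x = I y x" "\<And>y x. P y x = I y (clamp 0 1 x)"
    by metis
  have bound: "dist (I (apply_bcontfun y) t) (I (apply_bcontfun z) t) \<le> 1/2 * dist y z" if t: "t \<in> {0..1}" for y z t
  proof -
    define d where "d = dist y z"
    have d: "norm (y s - z s) \<le> d" for s
      unfolding d_def using dist_bounded[of y s z] by (simp add: dist_norm)
    have "((\<lambda>s. M * exp (2 * M * s) * d) has_integral
        d * exp (2 * M * t) / 2 - d * exp (2 * M * 0) / 2) {0..t}"
      using t by (intro fundamental_theorem_of_calculus)
        (auto intro!: derivative_eq_intros simp flip: has_real_derivative_iff_has_vector_derivative)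
    then have hi: "((\<lambda>s. M * exp (2 * M * s) * d) has_integral d * (exp (2 * M * t) - 1) / 2) {0..t}"
      by (simp add: algebra_simps diff_divide_distrib)
    have "norm (X (c y s) - X (c z s)) \<le> M * exp (2 * M * s) * d" for s
    proof -
      have "norm (X (c y s) - X (c z s)) \<le> M * norm (c y s - c z s)"
        using lipschitz_on_normD[OF M(2)] by auto
      also have "c y s - c z s = exp (2 * M * s) *\<^sub>R (y s - z s)"
        by (simp add: c_def algebra_simps)
      also have "M * norm (exp (2 * M * s) *\<^sub>R (y s - z s)) \<le> M * (exp (2 * M * s) * d)"
        using M d by (auto intro!: mult_left_mono)
      finally show ?thesis by (simp add: algebra_simps)
    qed
    then have "norm (integral {0..t} (\<lambda>s. X (c y s) - X (c z s)))
        \<le> integral {0..t} (\<lambda>s. M * exp (2 * M * s) * d)"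
      by (intro integral_norm_bound_integral integrable_diff integrable_continuous_real contc)
        (auto intro!: continuous_intros)
    also have "\<dots> = d * (exp (2 * M * t) - 1) / 2"
      using hi by (rule integral_unique)
    finally have "norm (integral {0..t} (\<lambda>s. X (c y s)) - integral {0..t} (\<lambda>s. X (c z s)))
        \<le> d * (exp (2 * M * t) - 1) / 2"
      by (subst integral_diff[symmetric]) (auto intro!: integrable_continuous_real contc)
    then have "exp (- 2 * M * t) * norm (integral {0..t} (\<lambda>s. X (c y s)) - integral {0..t} (\<lambda>s. X (c z s)))
        \<le> exp (- 2 * M * t) * (d * (exp (2 * M * t) - 1) / 2)"
      by (intro mult_left_mono) auto
    also have "\<dots> = d * (1 - exp (- 2 * M * t)) / 2"
      by (simp add: algebra_simps exp_minus_inverse flip: exp_add)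
    also have "\<dots> \<le> d / 2"
      using zero_le_dist[of y z] by (simp add: d_def mult_left_le)
    finally show ?thesis
      by (simp add: I_def dist_norm d_def flip: scaleR_right_diff_distrib)
  qed
  have "dist (P y) (P z) \<le> 1/2 * dist y z" for y z
  proof (rule dist_bound)
    fix t show "dist (P y t) (P z t) \<le> 1/2 * dist y z"
      unfolding P(2) using clamp_in_interval[of 0 "1::real" t] by (intro bound) simp
  qed
  then obtain y where y: "P y = y"
    using banach_fix_type[of "1/2" P] by auto
  define \<gamma> where "\<gamma> = c (apply_bcontfun y)"
  have eq: "\<gamma> t = x0 + integral {0..t} (\<lambda>s. X (\<gamma> s))" if "t \<in> {0..1}" for t
  proof -
    have "y t = I y t" using P(1)[OF that, of y] y by simp
    then have "exp (2 * M * t) *\<^sub>R y t = integral {0..t} (\<lambda>s. X (\<gamma> s))"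
      by (simp add: I_def \<gamma>_def flip: exp_add)
    then show ?thesis by (simp add: \<gamma>_def c_def[of _ t])
  qed
  have der: "((\<lambda>t. x0 + integral {0..t} (\<lambda>s. X (\<gamma> s))) has_vector_derivative X (\<gamma> t)) (at t within {0..1})"
    if "t \<in> {0..1}" for t
    unfolding \<gamma>_def using that
    by (auto intro!: derivative_eq_intros integral_has_vector_derivative contc)
  have "(\<gamma> has_vector_derivative X (\<gamma> t)) (at t within {0..1})" if "t \<in> {0..1}" for t
    using eq by (rule has_vector_derivative_transform[OF that _ der[OF that]])
  moreover have "\<gamma> 0 = x0" using eq[of 0] by simp
  ultimately show thesis using that by blast
qed

text \<open>McShane's extension: the infimum of the cones \<open>f k + L dist x k\<close> over \<open>k \<in> K\<close> has the slope of each cone,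
  and on \<open>K\<close> the Lipschitz bound makes the cone at the point itself the lowest one.\<close>

lemma lipschitz_extension_real:
  fixes f :: "'a::metric_space \<Rightarrow> real"
  assumes f: "L-lipschitz_on K f"
  obtains g where "L-lipschitz_on UNIV g" "\<And>x. x \<in> K \<Longrightarrow> g x = f x"
proof (cases "K = {}")
  case True
  have "L-lipschitz_on UNIV (\<lambda>x. 0::real)"
    using lipschitz_on_nonneg[OF f] by (intro lipschitz_onI) auto
  with True show thesis using that by auto
next
  case False
  then obtain k0 where k0: "k0 \<in> K" by auto
  have L: "L \<ge> 0" using lipschitz_on_nonneg[OF f] .
  define g where "g x = (INF k\<in>K. f k + L * dist x k)" for x
  have "f k0 - L * dist x k0 \<le> f k + L * dist x k" if "k \<in> K" for x k
  proof -
    have "f k0 - f k \<le> L * dist k0 k" using lipschitz_onD[OF f k0 that] by (auto simp: dist_real_def)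
    also have "\<dots> \<le> L * (dist x k0 + dist x k)"
      using L by (intro mult_left_mono) (auto simp: dist_triangle3)
    finally show ?thesis by (simp add: algebra_simps)
  qed
  then have bdd: "bdd_below ((\<lambda>k. f k + L * dist x k) ` K)" for x
    by (auto intro!: bdd_belowI2)
  have le: "g x \<le> g y + L * dist x y" for x y
  proof -
    have "g x - L * dist x y \<le> g y"
      unfolding g_def[of y]
    proof (rule cINF_greatest[OF False])
      fix k assume k: "k \<in> K"
      have "g x \<le> f k + L * dist x k"
        unfolding g_def by (rule cINF_lower[OF bdd k])
      also have "L * dist x k \<le> L * (dist x y + dist y k)"
        using L by (intro mult_left_mono) (auto simp: dist_triangle)
      finally show "g x - L * dist x y \<le> f k + L * dist y k" by (simp add: algebra_simps)
    qed
    then show ?thesis by simp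
  qed
  have "g x = f x" if x: "x \<in> K" for x
  proof (rule antisym)
    show "g x \<le> f x" unfolding g_def using cINF_lower[OF bdd x, of x] by simp
    show "f x \<le> g x" unfolding g_def
    proof (rule cINF_greatest[OF False])
      fix k assume k: "k \<in> K"
      show "f x \<le> f k + L * dist x k"
        using lipschitz_onD[OF f x k] by (auto simp: dist_real_def)
    qed
  qed
  moreover have "L-lipschitz_on UNIV g"
    using le L by (intro lipschitz_onI) (auto simp: dist_real_def abs_le_iff, (metis diff_le_eq add.commute dist_commute)+)
  ultimately show thesis using that by blast
qed

lemma lipschitz_extension:
  fixes f :: "'a::metric_space \<Rightarrow> 'b::euclidean_space"
  assumes f: "L-lipschitz_on K f"
  obtains g M where "M-lipschitz_on UNIV g" "\<And>x. x \<in> K \<Longrightarrow> g x = f x"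
proof -
  have "\<exists>g. L-lipschitz_on UNIV g \<and> (\<forall>x\<in>K. g x = f x \<bullet> b)" if "b \<in> Basis" for b
  proof -
    have "L-lipschitz_on K (\<lambda>x. f x \<bullet> b)"
      using lipschitz_onD[OF f] lipschitz_on_nonneg[OF f] Basis_le_norm[OF that]
      by (intro lipschitz_onI) (auto simp: dist_norm simp flip: inner_diff_left intro: order_trans)
    then show ?thesis by (rule lipschitz_extension_real) blast
  qed
  then obtain g where g: "\<And>b. b \<in> Basis \<Longrightarrow> L-lipschitz_on UNIV (g b)"
      "\<And>b x. b \<in> Basis \<Longrightarrow> x \<in> K \<Longrightarrow> g b x = f x \<bullet> b"
    by metis
  define h where "h x = (\<Sum>b\<in>Basis. g b x *\<^sub>R b)" for x
  have "(\<Sum>b\<in>(Basis::'b set). L)-lipschitz_on UNIV h"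
  proof (rule lipschitz_onI)
    fix x y
    have "dist (h x) (h y) = norm (\<Sum>b\<in>Basis. (g b x - g b y) *\<^sub>R b)"
      by (simp add: h_def dist_norm sum_subtractf algebra_simps)
    also have "\<dots> \<le> (\<Sum>b\<in>(Basis::'b set). L * dist x y)"
      using lipschitz_onD[OF g(1)] by (intro sum_norm_le) (auto simp: dist_real_def)
    finally show "dist (h x) (h y) \<le> (\<Sum>b\<in>(Basis::'b set). L) * dist x y"
      by (simp add: algebra_simps)
  qed (auto intro!: mult_nonneg_nonneg lipschitz_on_nonneg[OF f])
  moreover have "h x = f x" if "x \<in> K" for x
    by (simp add: h_def g(2) that euclidean_representation cong: sum.cong)
  ultimately show thesis using that by blast
qed

text \<open>This tangent set asks less of the curves than \<^const>\<open>tangent_space\<close>: they need a derivative at \<open>0\<close> only. That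
  suffices to keep solutions in \<open>K\<close>, and charts produce such curves without any smoothness argument.\<close>

definition velocities :: "'a::real_normed_vector set \<Rightarrow> 'a \<Rightarrow> 'a set" where
  "velocities K x = {v. \<exists>\<gamma>. \<gamma> 0 = x \<and> (\<forall>\<^sub>F t in nhds 0. \<gamma> t \<in> K) \<and>
     (\<gamma> has_vector_derivative v) (at (0::real))}"

lemma vector_derivative_first_order:
  assumes "(\<gamma> has_vector_derivative v) (at t within S)" and "e > 0"
  obtains d where "d > 0" "\<And>s. s \<in> S \<Longrightarrow> \<bar>s - t\<bar> < d \<Longrightarrow> norm (\<gamma> s - \<gamma> t - (s - t) *\<^sub>R v) \<le> e * \<bar>s - t\<bar>"
  using assms unfolding has_vector_derivative_def has_derivative_within_alt
  by (metis real_norm_def)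

text \<open>A Nagumo type invariance principle. Extend \<open>X\<close> to a Lipschitz field \<open>Y\<close> and solve there. If \<open>k \<in> K\<close> is
  nearest to \<open>\<gamma> t\<close>, then some curve in \<open>K\<close> leaves \<open>k\<close> with velocity \<open>Y k\<close>, which differs from the velocity of \<open>\<gamma>\<close>
  by at most \<open>M\<close> times the distance \<open>d t\<close> of \<open>\<gamma> t\<close> from \<open>K\<close>. Hence \<open>d\<close> grows at rate at most \<open>M d\<close>, and
  \<open>d 0 = 0\<close> forces \<open>d = 0\<close>.\<close>

lemma lipschitz_ode_solution_in:
  fixes X :: "'a::euclidean_space \<Rightarrow> 'a"
  assumes K: "closed K" and X: "L-lipschitz_on K X" and tangent: "\<And>x. x \<in> K \<Longrightarrow> X x \<in> velocities K x"
    and x0: "x0 \<in> K"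
  obtains \<gamma> where "\<gamma> 0 = x0" "\<gamma> ` {0..1} \<subseteq> K"
    and "\<And>t. t \<in> {0..1} \<Longrightarrow> (\<gamma> has_vector_derivative X (\<gamma> t)) (at t within {0..1})"
proof -
  obtain Y M where Y: "M-lipschitz_on UNIV Y" "\<And>x. x \<in> K \<Longrightarrow> Y x = X x"
    by (rule lipschitz_extension[OF X]) blast
  obtain \<gamma> where \<gamma>: "\<gamma> 0 = x0"
      "\<And>t. t \<in> {0..1} \<Longrightarrow> (\<gamma> has_vector_derivative Y (\<gamma> t)) (at t within {0..1})"
    using lipschitz_ode_solution[OF Y(1)] by metis
  have M: "M \<ge> 0" using lipschitz_on_nonneg[OF Y(1)] .
  have cont: "continuous_on {0..1} \<gamma>"
    using \<gamma>(2) has_vector_derivative_continuous continuous_on_eq_continuous_within by blast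
  define d where "d t = infdist (\<gamma> t) K" for t
  have contd: "continuous_on {0..1} d"
    unfolding d_def by (intro continuous_intros cont)
  have step: "\<exists>\<delta>>0. \<forall>h\<in>{0<..<\<delta>}. t + h \<le> 1 \<longrightarrow> d (t + h) \<le> d t + h * (M * d t + e)"
    if t: "t \<in> {0..1}" and e: "e > 0" for t e
  proof -
    obtain k where k: "k \<in> K" "infdist (\<gamma> t) K = dist (\<gamma> t) k"
      using infdist_attains_inf[OF K] x0 by blast
    have "Y k \<in> velocities K k" using tangent k(1) Y(2) by simp
    then obtain \<beta> where \<beta>: "\<beta> 0 = k" "\<forall>\<^sub>F t in nhds 0. \<beta> t \<in> K"
        "(\<beta> has_vector_derivative Y k) (at 0)"
      by (auto simp: velocities_def)
    obtain d1 where d1: "d1 > 0" "\<And>s. \<bar>s\<bar> < d1 \<Longrightarrow> \<beta> s \<in> K"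
      using \<beta>(2) unfolding eventually_nhds_metric by (auto simp: dist_real_def)
    obtain d2 where d2: "d2 > 0" "\<And>s. \<bar>s\<bar> < d2 \<Longrightarrow> norm (\<beta> s - k - s *\<^sub>R Y k) \<le> e/2 * \<bar>s\<bar>"
      using vector_derivative_first_order[OF \<beta>(3), of "e/2"] e \<beta>(1) by auto
    obtain d3 where d3: "d3 > 0" "\<And>s. s \<in> {0..1} \<Longrightarrow> \<bar>s - t\<bar> < d3 \<Longrightarrow>
        norm (\<gamma> s - \<gamma> t - (s - t) *\<^sub>R Y (\<gamma> t)) \<le> e/2 * \<bar>s - t\<bar>"
      using vector_derivative_first_order[OF \<gamma>(2)[OF t], of "e/2"] e by auto
    have "d (t + h) \<le> d t + h * (M * d t + e)"
      if h: "0 < h" "h < min d1 (min d2 d3)" "t + h \<le> 1" for h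
    proof -
      have "norm (\<gamma> (t+h) - \<beta> h) = norm ((\<gamma> (t+h) - \<gamma> t - h *\<^sub>R Y (\<gamma> t)) - (\<beta> h - k - h *\<^sub>R Y k)
          + (\<gamma> t - k) + h *\<^sub>R (Y (\<gamma> t) - Y k))"
        by (simp add: algebra_simps)
      also have "\<dots> \<le> norm (\<gamma> (t+h) - \<gamma> t - h *\<^sub>R Y (\<gamma> t)) + norm (\<beta> h - k - h *\<^sub>R Y k)
          + norm (\<gamma> t - k) + norm (h *\<^sub>R (Y (\<gamma> t) - Y k))"
        by (intro norm_triangle_le add_mono order_refl norm_triangle_ineq4 order_trans[OF norm_triangle_ineq])
      also have "\<dots> \<le> e/2 * h + e/2 * h + d t + h * (M * d t)"
        using d2(2)[of h] d3(2)[of "t+h"] h t lipschitz_on_normD[OF Y(1), of "\<gamma> t" k] k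
        by (intro add_mono) (auto simp: d_def dist_norm)
      finally have "norm (\<gamma> (t+h) - \<beta> h) \<le> d t + h * (M * d t + e)" by (simp add: algebra_simps)
      moreover have "d (t + h) \<le> dist (\<gamma> (t+h)) (\<beta> h)"
        unfolding d_def using d1(2)[of h] h by (intro infdist_le) auto
      ultimately show ?thesis by (simp add: dist_norm)
    qed
    then show ?thesis using d1(1) d2(1) d3(1)
      by (intro exI[of _ "min d1 (min d2 d3)"]) auto
  qed
  \<comment> \<open>Compare with the exponential \<open>b\<close> of larger rate \<open>M + 1\<close>,
    starting at \<open>e\<close>, and look at the infimum of the times at which \<open>d\<close> exceeds
    \<open>b\<close>.\<close>
  have small: "d t \<le> e * exp ((M + 1) * t)" if t: "t \<in> {0..1}" and e: "e > 0" for t e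
  proof (rule ccontr)
    define b where "b t = e * exp ((M + 1) * t)" for t
    assume "\<not> d t \<le> e * exp ((M + 1) * t)"
    then have tA: "t \<in> {s \<in> {0..1}. b s < d s}" (is "_ \<in> ?A") using t by (auto simp: b_def)
    define s where "s = Inf ?A"
    have bddA: "bdd_below ?A" by (intro bdd_belowI[of _ 0]) auto
    have s01: "s \<in> {0..1}"
      using cInf_lower[OF tA bddA] t cInf_greatest[of ?A 0] tA unfolding s_def by fastforce
    have before: "d r \<le> b r" if "r \<in> {0..<s}" for r
      using cInf_lower[OF _ bddA, of r] that s01 unfolding s_def by force
    have at_s: "d s \<le> b s"
    proof (cases "s = 0")
      case True
      then show ?thesis using x0 \<gamma>(1) e by (simp add: d_def b_def)
    next
      case False
      have "continuous_on {0..s} d" "continuous_on {0..s} b"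
        using s01 by (auto intro!: continuous_on_subset[OF contd] continuous_intros simp: b_def)
      moreover have "closure {0..<s} = {0..s}" using False s01 by simp
      ultimately have "continuous_on (closure {0..<s}) (\<lambda>r. b r - d r)"
        by (auto intro!: continuous_intros)
      then have "0 \<le> b s - d s"
        by (rule continuous_ge_on_closure) (use False s01 before in auto)
      then show ?thesis by simp
    qed
    obtain \<delta> where \<delta>: "\<delta> > 0"
      "\<And>h. h \<in> {0<..<\<delta>} \<Longrightarrow> s + h \<le> 1 \<Longrightarrow> d (s + h) \<le> d s + h * (M * d s + e)"
      using step[OF s01 e] by metis
    have "\<exists>r\<in>?A. r < s + \<delta>"
      using cInf_less_iff[OF _ bddA, of "s + \<delta>"] tA \<delta>(1) unfolding s_def by auto
    then obtain r where r: "r \<in> {0..1}" "b r < d r" "r < s + \<delta>" by auto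
    have "s \<le> r" using cInf_lower[OF _ bddA, of r] r unfolding s_def by auto
    moreover have "r \<noteq> s" using at_s r by auto
    ultimately have sr: "s < r" by simp
    define h where "h = r - s"
    have h: "h > 0" "h < \<delta>" "s + h = r" using sr r by (auto simp: h_def)
    have "e \<le> b s" using e M s01 by (auto simp: b_def)
    have "d r \<le> d s + h * (M * d s + e)" using \<delta>(2)[of h] h r by auto
    also have "\<dots> \<le> b s + h * (M * b s + b s)"
      using at_s M h \<open>e \<le> b s\<close> by (intro add_mono mult_left_mono) auto
    also have "\<dots> = b s * (1 + (M + 1) * h)" by (simp add: algebra_simps)
    also have "\<dots> \<le> b s * exp ((M + 1) * h)"
      using e by (intro mult_left_mono) (auto simp: b_def)
    also have "\<dots> = b r" by (simp add: b_def algebra_simps flip: h(3) exp_add)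
    finally show False using r by simp
  qed
  have inK: "\<gamma> t \<in> K" if t: "t \<in> {0..1}" for t
  proof -
    have "d t \<le> 0 + e" if "e > 0" for e
      using small[OF t, of "e / exp ((M + 1) * t)"] that by simp
    then have "d t \<le> 0" using field_le_epsilon by blast
    then have "infdist (\<gamma> t) K = 0" unfolding d_def using infdist_nonneg[of "\<gamma> t" K] by linarith
    then show ?thesis using in_closed_iff_infdist_zero[OF K] x0 by blast
  qed
  show thesis
    using that[of \<gamma>] \<gamma> inK Y(2) by fastforce
qed

text \<open>Gronwall's inequality for \<open>\<parallel>\<alpha> - \<beta>\<parallel>\<^sup>2 + \<delta>\<^sup>2\<close>, where \<open>\<delta>\<close> bounds the effect of changing the speed from \<open>a\<close>
  to \<open>b\<close>. The factor \<open>a\<close> stands for the time for which the flow of \<open>X\<close> is followed, so that this is joint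
  continuity of the flow in time and initial value.\<close>

lemma lipschitz_ode_dependence:
  fixes X :: "'a::euclidean_space \<Rightarrow> 'a"
  assumes X: "L-lipschitz_on K X" and C: "\<And>x. x \<in> K \<Longrightarrow> norm (X x) \<le> C"
    and \<alpha>: "\<alpha> ` {0..1} \<subseteq> K" "\<And>t. t \<in> {0..1} \<Longrightarrow> (\<alpha> has_vector_derivative a *\<^sub>R X (\<alpha> t)) (at t within {0..1})"
    and \<beta>: "\<beta> ` {0..1} \<subseteq> K" "\<And>t. t \<in> {0..1} \<Longrightarrow> (\<beta> has_vector_derivative b *\<^sub>R X (\<beta> t)) (at t within {0..1})"
  shows "(dist (\<alpha> 1) (\<beta> 1))\<^sup>2 \<le> ((dist (\<alpha> 0) (\<beta> 0))\<^sup>2 + (\<bar>a - b\<bar> * C)\<^sup>2) * exp (2 * \<bar>a\<bar> * L + 1)"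
proof -
  define c where "c = 2 * \<bar>a\<bar> * L + 1"
  define D where "D t = \<alpha> t - \<beta> t" for t
  define V where "V t = a *\<^sub>R X (\<alpha> t) - b *\<^sub>R X (\<beta> t)" for t
  define \<delta> where "\<delta> = \<bar>a - b\<bar> * C"
  define g where "g t = (D t \<bullet> D t + \<delta>\<^sup>2) * exp (- (c * t))" for t
  have D: "(D has_vector_derivative V t) (at t within {0..1})" if "t \<in> {0..1}" for t
    unfolding D_def V_def using \<alpha>(2) \<beta>(2) that by (intro derivative_intros)
  have g: "(g has_real_derivative (2 * (D t \<bullet> V t) - c * (D t \<bullet> D t + \<delta>\<^sup>2)) * exp (- (c * t)))
      (at t within {0..1})" if "t \<in> {0..1}" for t
  proof -
    have "((\<lambda>t. D t \<bullet> D t) has_vector_derivative D t \<bullet> V t + V t \<bullet> D t) (at t within {0..1})"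
      by (rule bounded_bilinear.has_vector_derivative[OF bounded_bilinear_inner D[OF that] D[OF that]])
    then have "((\<lambda>t. D t \<bullet> D t) has_real_derivative 2 * (D t \<bullet> V t)) (at t within {0..1})"
      by (simp add: has_real_derivative_iff_has_vector_derivative inner_commute)
    then show ?thesis
      unfolding g_def by (auto intro!: derivative_eq_intros simp: algebra_simps)
  qed
  have "g 1 \<le> g 0"
  proof (rule DERIV_nonpos_imp_decreasing_open[of 0 1])
    fix t :: real assume t: "0 < t" "t < 1"
    have "2 * (D t \<bullet> V t) \<le> c * (D t \<bullet> D t + \<delta>\<^sup>2)"
    proof -
      have K: "\<alpha> t \<in> K" "\<beta> t \<in> K" using \<alpha>(1) \<beta>(1) t by auto
      have L: "L \<ge> 0" using lipschitz_on_nonneg[OF X] .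
      have "V t = a *\<^sub>R (X (\<alpha> t) - X (\<beta> t)) + (a - b) *\<^sub>R X (\<beta> t)"
        by (simp add: V_def algebra_simps)
      then have "norm (V t) \<le> \<bar>a\<bar> * norm (X (\<alpha> t) - X (\<beta> t)) + \<bar>a - b\<bar> * norm (X (\<beta> t))"
        by (metis norm_triangle_ineq norm_scaleR)
      also have "\<dots> \<le> \<bar>a\<bar> * (L * norm (D t)) + \<delta>"
        unfolding \<delta>_def D_def
        by (intro add_mono mult_left_mono C K lipschitz_on_normD[OF X]) auto
      finally have "D t \<bullet> V t \<le> norm (D t) * (\<bar>a\<bar> * (L * norm (D t)) + \<delta>)"
        by (meson mult_left_mono norm_cauchy_schwarz norm_ge_zero order_trans)
      then have "2 * (D t \<bullet> V t) \<le> 2 * \<bar>a\<bar> * L * (norm (D t))\<^sup>2 + 2 * norm (D t) * \<delta>"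
        by (simp add: algebra_simps power2_eq_square)
      also have "2 * norm (D t) * \<delta> \<le> (norm (D t))\<^sup>2 + \<delta>\<^sup>2"
        by (rule sum_squares_bound)
      finally have "2 * (D t \<bullet> V t) \<le> c * (norm (D t))\<^sup>2 + \<delta>\<^sup>2"
        by (simp add: c_def algebra_simps)
      also have "\<dots> \<le> c * (norm (D t))\<^sup>2 + c * \<delta>\<^sup>2"
        using L by (simp add: c_def algebra_simps)
      finally show ?thesis by (simp add: algebra_simps power2_norm_eq_inner)
    qed
    then have "(2 * (D t \<bullet> V t) - c * (D t \<bullet> D t + \<delta>\<^sup>2)) * exp (- (c * t)) \<le> 0"
      by (intro mult_nonpos_nonneg) auto
    moreover have "at t within {0..1} = at t" using t by (simp add: at_within_Icc_at)
    ultimately show "\<exists>y. (g has_real_derivative y) (at t) \<and> y \<le> 0"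
      using g[of t] t by auto
  next
    show "continuous_on {0..1} g"
      using g by (rule DERIV_continuous_on)
  qed simp
  then have "(D 1 \<bullet> D 1 + \<delta>\<^sup>2) * exp (- c) * exp c \<le> (D 0 \<bullet> D 0 + \<delta>\<^sup>2) * exp c"
    by (intro mult_right_mono) (auto simp: g_def)
  then have "D 1 \<bullet> D 1 + \<delta>\<^sup>2 \<le> (D 0 \<bullet> D 0 + \<delta>\<^sup>2) * exp c"
    by (simp add: mult.assoc flip: exp_add)
  then have "D 1 \<bullet> D 1 \<le> (D 0 \<bullet> D 0 + \<delta>\<^sup>2) * exp c"
    using zero_le_power2[of \<delta>] by linarith
  then show ?thesis
    by (simp add: D_def \<delta>_def c_def dist_norm power2_norm_eq_inner)
qed

text \<open>A function that is stationary whenever it is below the level \<open>m\<close> cannot cross \<open>m\<close> downwards: after the last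
  time at which it was at least \<open>m\<close> it would be constant.\<close>

lemma stays_above_level:
  fixes g :: "real \<Rightarrow> real"
  assumes g: "\<And>t. t \<in> {0..1} \<Longrightarrow> (g has_real_derivative g' t) (at t within {0..1})"
    and zero: "\<And>t. t \<in> {0..1} \<Longrightarrow> g t < m \<Longrightarrow> g' t = 0"
    and g0: "g 0 \<ge> m" and t: "t \<in> {0..1}"
  shows "g t \<ge> m"
proof (rule ccontr)
  assume neg: "\<not> m \<le> g t"
  define S where "S = {s \<in> {0..t}. m \<le> g s}"
  have cont: "continuous_on {0..t} g"
    using t by (intro continuous_on_subset[OF DERIV_continuous_on[OF g]]) auto
  have "closed S" unfolding S_def
    using continuous_on_closed_Collect_le[OF continuous_on_const cont] by simp
  moreover have "S \<noteq> {}" using g0 t by (auto simp: S_def intro!: exI[of _ 0])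
  moreover have bdd: "bdd_above S" by (auto simp: S_def)
  ultimately have sS: "Sup S \<in> S" using closed_contains_Sup by blast
  define s where "s = Sup S"
  have s: "0 \<le> s" "s < t" "m \<le> g s" using sS neg by (auto simp: S_def s_def less_le)
  have after: "g r < m" if "s < r" "r \<le> t" for r
    using cSup_upper[OF _ bdd, of r] that s by (force simp: S_def s_def)
  have "g t = g s"
  proof (rule DERIV_isconst_end[OF s(2)])
    show "continuous_on {s..t} g"
      using s by (intro continuous_on_subset[OF cont]) auto
    fix r assume r: "s < r" "r < t"
    then have "(g has_real_derivative 0) (at r within {0..1})"
      using g[of r] zero[of r] after[of r] s t by auto
    moreover have "at r within {0..1} = at r" using r s t by (simp add: at_within_Icc_at)
    ultimately show "(g has_real_derivative 0) (at r)" by simp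
  qed
  then show False using s neg by simp
qed

section \<open>Lipschitz maps on compact sets\<close>

text \<open>On compact sets, the maps that are Lipschitz with some constant are closed under sums and products.\<close>

abbreviation lip :: "'a::metric_space set \<Rightarrow> ('a \<Rightarrow> 'b::metric_space) \<Rightarrow> bool" where
  "lip K f \<equiv> \<exists>L. L-lipschitz_on K f"

lemma lip_continuous_on: "lip K f \<Longrightarrow> continuous_on K f"
  using lipschitz_on_continuous_on by blast

lemma lip_subset: "lip K f \<Longrightarrow> S \<subseteq> K \<Longrightarrow> lip S f"
  using lipschitz_on_subset by blast

lemma lip_bounded:
  fixes f :: "'a::metric_space \<Rightarrow> 'b::real_normed_vector"
  assumes "compact K" "lip K f"
  obtains C where "C > 0" "\<And>x. x \<in> K \<Longrightarrow> norm (f x) \<le> C"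
proof -
  have "bounded (f ` K)"
    using assms lip_continuous_on compact_continuous_image compact_imp_bounded by metis
  then show thesis using that unfolding bounded_pos by auto
qed

text \<open>On a compact set products of Lipschitz maps are Lipschitz. If the scalar factor vanishes off \<open>S\<close>, then
  the other factor is only needed on \<open>S\<close>: between a point of \<open>S\<close> and a point off \<open>S\<close> the product changes as little as
  the scalar does. This is how fields that are only defined locally become global.\<close>

lemma lip_scaleR_cutoff:
  fixes f :: "'a::metric_space \<Rightarrow> 'b::real_normed_vector"
  assumes W: "compact W" and \<rho>: "lip W \<rho>" "\<And>x. x \<in> W \<Longrightarrow> x \<notin> S \<Longrightarrow> \<rho> x = 0"
    and S: "compact S" "S \<subseteq> W" and f: "lip S f"
  shows "lip W (\<lambda>x. \<rho> x *\<^sub>R f x)"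
proof -
  obtain A B where AB: "A-lipschitz_on W \<rho>" "B-lipschitz_on S f" using \<rho> f by auto
  obtain R where R: "R > 0" "\<And>x. x \<in> W \<Longrightarrow> norm (\<rho> x) \<le> R" using lip_bounded[OF W \<rho>(1)] by blast
  obtain C where C: "C > 0" "\<And>x. x \<in> S \<Longrightarrow> norm (f x) \<le> C" using lip_bounded[OF S(1) f] by blast
  have AB0: "A \<ge> 0" "B \<ge> 0" using AB lipschitz_on_nonneg by auto
  have one: "norm (\<rho> x *\<^sub>R f x - \<rho> y *\<^sub>R f y) \<le> (R * B + A * C) * dist x y"
    if "x \<in> S" "y \<in> W" for x y
  proof (cases "y \<in> S")
    case True
    have "\<rho> x *\<^sub>R f x - \<rho> y *\<^sub>R f y = \<rho> y *\<^sub>R (f x - f y) + (\<rho> x - \<rho> y) *\<^sub>R f x"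
      by (simp add: algebra_simps)
    also have "norm \<dots> \<le> \<bar>\<rho> y\<bar> * norm (f x - f y) + \<bar>\<rho> x - \<rho> y\<bar> * norm (f x)"
      by (rule norm_triangle_le) simp
    also have "\<dots> \<le> R * (B * dist x y) + (A * dist x y) * C"
      using R(2)[OF that(2)] R(1) C AB0 True that S(2) lipschitz_onD[OF AB(1), of x y] lipschitz_onD[OF AB(2), of x y]
      by (intro add_mono mult_mono) (auto simp: dist_norm)
    finally show ?thesis by (simp add: algebra_simps)
  next
    case False
    then have "norm (\<rho> x *\<^sub>R f x - \<rho> y *\<^sub>R f y) = \<bar>\<rho> x - \<rho> y\<bar> * norm (f x)"
      using \<rho>(2)[OF that(2)] by simp
    also have "\<dots> \<le> (A * dist x y) * C"
      using C AB0 that S(2) lipschitz_onD[OF AB(1), of x y]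
      by (intro mult_mono) (auto simp: dist_norm)
    also have "\<dots> \<le> (R * B + A * C) * dist x y" using AB0 R(1) by (simp add: algebra_simps)
    finally show ?thesis .
  qed
  have "(R * B + A * C)-lipschitz_on W (\<lambda>x. \<rho> x *\<^sub>R f x)"
  proof (rule lipschitz_onI)
    show "0 \<le> R * B + A * C" using AB0 R C by auto
    fix x y assume xy: "x \<in> W" "y \<in> W"
    consider "x \<in> S" | "y \<in> S" | "x \<notin> S" "y \<notin> S" by blast
    then show "dist (\<rho> x *\<^sub>R f x) (\<rho> y *\<^sub>R f y) \<le> (R * B + A * C) * dist x y"
    proof cases
      case 1 then show ?thesis using one[of x y] xy by (simp add: dist_norm)
    next
      case 2 then show ?thesis using one[of y x] xy by (metis dist_commute dist_norm)
    next
      case 3 then show ?thesis using \<rho>(2) xy AB0 R C by simp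
    qed
  qed
  then show ?thesis by blast
qed

lemma lip_scaleR:
  fixes f :: "'a::metric_space \<Rightarrow> 'b::real_normed_vector"
  assumes "compact K" "lip K \<rho>" "lip K f"
  shows "lip K (\<lambda>x. \<rho> x *\<^sub>R f x)"
  using lip_scaleR_cutoff[OF assms(1,2) _ assms(1) order_refl assms(3)] by auto

lemma lip_add:
  fixes f g :: "'a::metric_space \<Rightarrow> 'b::real_normed_vector"
  shows "lip K f \<Longrightarrow> lip K g \<Longrightarrow> lip K (\<lambda>x. f x + g x)"
  using lipschitz_on_add by blast

lemma lip_sum:
  fixes f :: "'i \<Rightarrow> 'a::metric_space \<Rightarrow> 'b::real_normed_vector"
  assumes "\<And>i. i \<in> I \<Longrightarrow> lip K (f i)"
  shows "lip K (\<lambda>x. \<Sum>i\<in>I. f i x)"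
  using assms
proof (induction I rule: infinite_finite_induct)
  case (insert i I)
  then show ?case by (simp add: lip_add)
qed (auto intro: lipschitz_on_constant)

lemma lip_linear:
  assumes "bounded_linear A" "lip K f"
  shows "lip K (\<lambda>x. A (f x))"
proof -
  obtain B where "B-lipschitz_on (f ` K) A"
    by (rule bounded_linear.lipschitz_boundE[OF assms(1)])
  then show ?thesis using lipschitz_on_compose2 assms(2) by blast
qed

lemma lip_inner:
  fixes f g :: "'a::metric_space \<Rightarrow> 'b::euclidean_space"
  assumes "compact K" "lip K f" "lip K g"
  shows "lip K (\<lambda>x. f x \<bullet> g x)"
proof -
  have comp: "lip K (\<lambda>x. h x \<bullet> b)" if "lip K h" for h :: "'a \<Rightarrow> 'b" and b
    using lip_linear[OF bounded_linear_inner_left that] .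
  have "lip K (\<lambda>x. \<Sum>b\<in>Basis. (f x \<bullet> b) *\<^sub>R (g x \<bullet> b))"
    by (intro lip_sum lip_scaleR comp assms)
  moreover have "(\<lambda>x. f x \<bullet> g x) = (\<lambda>x. \<Sum>b\<in>Basis. (f x \<bullet> b) *\<^sub>R (g x \<bullet> b))"
    by (intro ext trans[OF euclidean_inner]) simp
  ultimately show ?thesis by (simp only:)
qed

lemma lip_compose_norm:
  fixes f :: "'a::metric_space \<Rightarrow> 'b::real_normed_vector" and g :: "real \<Rightarrow> real"
  assumes "lip K f" and g: "\<And>s t. \<bar>g s - g t\<bar> \<le> \<bar>s - t\<bar>"
  shows "lip K (\<lambda>x. g (norm (f x)))"
proof -
  obtain L where L: "L-lipschitz_on K f" using assms(1) by blast
  have gf: "dist (g (norm (f x))) (g (norm (f y))) \<le> dist (f x) (f y)" for x y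
    unfolding dist_real_def dist_norm using g norm_triangle_ineq3 order_trans by blast
  have "L-lipschitz_on K (\<lambda>x. g (norm (f x)))"
    by (intro lipschitz_onI order_trans[OF gf lipschitz_onD[OF L]] lipschitz_on_nonneg[OF L])
  then show ?thesis by blast
qed

lemma C1_lip_compact_convex:
  fixes f :: "'a::euclidean_space \<Rightarrow> 'b::euclidean_space"
  assumes "Ck_on 1 U f" "K \<subseteq> U" "compact K" "convex K"
  shows "lip K f"
proof -
  obtain f' where f': "\<And>x. x \<in> U \<Longrightarrow> (f has_derivative f' x) (at x)"
      "\<And>v. continuous_on U (\<lambda>x. f' x v)"
    using assms(1) by auto
  define g where "g x = (\<Sum>b\<in>Basis. norm (f' x b))" for x
  have "continuous_on K g"
    unfolding g_def using continuous_on_subset[OF f'(2) assms(2)] by (intro continuous_intros)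
  then have "bounded (g ` K)"
    using compact_continuous_image[OF _ assms(3)] compact_imp_bounded by blast
  then obtain B where B: "B > 0" "\<And>x. x \<in> K \<Longrightarrow> g x \<le> B"
    unfolding bounded_pos by (auto simp: abs_le_iff)
  have "onorm (f' x) \<le> B" if "x \<in> K" for x
  proof (rule onorm_le)
    fix v
    interpret linear "f' x" using f'(1) that assms(2) has_derivative_linear by blast
    have "norm (f' x v) = norm (\<Sum>b\<in>Basis. (v \<bullet> b) *\<^sub>R f' x b)"
      by (subst euclidean_representation[of v, symmetric]) (simp add: sum scale)
    also have "\<dots> \<le> (\<Sum>b\<in>Basis. norm v * norm (f' x b))"
      by (intro sum_norm_le) (auto intro!: mult_right_mono simp: Basis_le_norm)
    also have "\<dots> = norm v * g x" by (simp add: g_def sum_distrib_left)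
    also have "\<dots> \<le> B * norm v" using mult_left_mono[OF B(2)[OF that] norm_ge_zero[of v]] by (simp add: mult.commute)
    finally show "norm (f' x v) \<le> B * norm v" .
  qed
  then have "norm (f x - f y) \<le> B * norm (x - y)" if "x \<in> K" "y \<in> K" for x y
    using differentiable_bound[OF assms(4), of f f' B x y] f'(1) assms(2) that
    by (meson has_derivative_at_withinI subsetD)
  then have "B-lipschitz_on K f" using B(1) by (intro lipschitz_onI) (auto simp: dist_norm)
  then show ?thesis by blast
qed

lemma C1_lip_compact:
  fixes f :: "'a::euclidean_space \<Rightarrow> 'b::euclidean_space"
  assumes "Ck_on 1 UNIV f" "compact K"
  shows "lip K f"
proof -
  obtain p R where "K \<subseteq> cball p R"
    using compact_imp_bounded[OF assms(2)] by (auto simp: bounded_subset_cball)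
  then show ?thesis
    using lip_subset[OF C1_lip_compact_convex[OF assms(1) subset_UNIV compact_cball convex_cball]] by blast
qed

lemma Ck_on_pred: "Ck_on (Suc k) U f \<Longrightarrow> Ck_on k U f"
proof (induction k arbitrary: f)
  case 0
  then show ?case
    by (auto intro!: continuous_at_imp_continuous_on dest: has_derivative_continuous)
next
  case (Suc k)
  then show ?case by (metis Ck_on.simps(2))
qed

text \<open>On the compact set \<open>K\<close> the form \<open>v \<bullet> Q x v\<close> is bounded below by \<open>m \<parallel>v\<parallel>\<^sup>2\<close> with one \<open>m > 0\<close>, so all solution
  operators are bounded by \<open>1/m\<close>. The claim then follows from
  \<open>Q x (s x - s y) = (b x - b y) - (Q x - Q y) (s y)\<close>.\<close>

lemma lip_solution_of_definite_system:
  fixes Q :: "'a::metric_space \<Rightarrow> 'b::euclidean_space \<Rightarrow> 'b"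
  assumes K: "compact K" and lin: "\<And>x. x \<in> K \<Longrightarrow> linear (Q x)"
    and Q: "\<And>v. lip K (\<lambda>x. Q x v)"
    and pos: "\<And>x v. x \<in> K \<Longrightarrow> v \<noteq> 0 \<Longrightarrow> v \<bullet> Q x v > 0"
    and b: "lip K b" and s: "\<And>x. x \<in> K \<Longrightarrow> Q x (s x) = b x"
  shows "lip K s"
proof (cases "K = {}")
  case True
  then show ?thesis using zero_le_one by (auto simp del: zero_le_one)
next
  case False
  have Qsum: "Q x v = (\<Sum>e\<in>Basis. (v \<bullet> e) *\<^sub>R Q x e)" if "x \<in> K" for x v
  proof -
    interpret linear "Q x" using lin[OF that] .
    show ?thesis
      by (subst euclidean_representation[of v, symmetric]) (simp only: sum scale)
  qed
  have contQ: "continuous_on (K \<times> sphere 0 1) (\<lambda>z. Q (fst z) e)" for e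
    using lip_continuous_on[OF Q[of e]]
    by (rule continuous_on_compose2) (auto intro!: continuous_intros)
  have "continuous_on (K \<times> sphere 0 1) (\<lambda>z. snd z \<bullet> (\<Sum>e\<in>Basis. (snd z \<bullet> e) *\<^sub>R Q (fst z) e))"
    by (intro continuous_intros contQ)
  moreover have "compact (K \<times> (sphere 0 1 :: 'b set))" "K \<times> (sphere 0 1 :: 'b set) \<noteq> {}"
    using K False by (auto simp: compact_Times)
  ultimately have "\<exists>z\<in>K \<times> sphere 0 1. \<forall>y\<in>K \<times> sphere 0 1.
      snd z \<bullet> (\<Sum>e\<in>Basis. (snd z \<bullet> e) *\<^sub>R Q (fst z) e) \<le> snd y \<bullet> (\<Sum>e\<in>Basis. (snd y \<bullet> e) *\<^sub>R Q (fst y) e)"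
    by (intro continuous_attains_inf)
  then obtain z where z: "z \<in> K \<times> sphere 0 1"
      "\<And>y. y \<in> K \<times> sphere 0 1 \<Longrightarrow> snd z \<bullet> Q (fst z) (snd z) \<le> snd y \<bullet> Q (fst y) (snd y)"
    by (auto simp flip: Qsum)
  define m where "m = snd z \<bullet> Q (fst z) (snd z)"
  have m: "m > 0" unfolding m_def using z(1) by (intro pos) auto
  have coer: "m * (norm v)\<^sup>2 \<le> v \<bullet> Q x v" if x: "x \<in> K" for x v
  proof (cases "v = 0")
    case False
    interpret linear "Q x" using lin[OF x] .
    have "m \<le> (v /\<^sub>R norm v) \<bullet> Q x (v /\<^sub>R norm v)"
      using z(2)[of "(x, v /\<^sub>R norm v)"] x False by (auto simp: m_def)
    also have "\<dots> = (v \<bullet> Q x v) / (norm v)\<^sup>2" by (simp add: scale power2_eq_square divide_inverse)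
    finally show ?thesis using False by (simp add: field_simps)
  qed simp
  have inv: "m * norm v \<le> norm (Q x v)" if "x \<in> K" for x v
  proof (cases "v = 0")
    case False
    have "m * norm v * norm v \<le> norm v * norm (Q x v)"
      using coer[OF that, of v] norm_cauchy_schwarz[of v "Q x v"] by (simp add: power2_eq_square)
    then show ?thesis using False by (simp add: mult.commute)
  qed simp
  obtain B where B: "B > 0" "\<And>x. x \<in> K \<Longrightarrow> norm (b x) \<le> B" using lip_bounded[OF K b] by blast
  obtain Lb where Lb: "Lb-lipschitz_on K b" using b by blast
  obtain LQ where LQ: "\<And>e. (LQ e)-lipschitz_on K (\<lambda>x. Q x e)" using Q by metis
  define C where "C = (\<Sum>e\<in>Basis. LQ e)"
  have C: "C \<ge> 0" unfolding C_def using LQ lipschitz_on_nonneg by (intro sum_nonneg) blast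
  have Lb0: "Lb \<ge> 0" using lipschitz_on_nonneg[OF Lb] .
  have "((Lb + C * (B / m)) / m)-lipschitz_on K s"
  proof (rule lipschitz_onI)
    show "0 \<le> (Lb + C * (B / m)) / m" using m B C Lb0 by simp
    fix x y assume xy: "x \<in> K" "y \<in> K"
    interpret linear "Q x" using lin[OF xy(1)] .
    have "Q x (s x - s y) = (b x - b y) - (Q x (s y) - Q y (s y))"
      using s xy by (simp add: diff)
    then have "m * norm (s x - s y) \<le> norm ((b x - b y) - (Q x (s y) - Q y (s y)))"
      using inv[OF xy(1), of "s x - s y"] by simp
    also have "\<dots> \<le> norm (b x - b y) + norm (Q x (s y) - Q y (s y))" by (rule norm_triangle_ineq4)
    also have "norm (b x - b y) \<le> Lb * dist x y" using lipschitz_onD[OF Lb xy] by (simp add: dist_norm)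
    also have "norm (Q x (s y) - Q y (s y)) \<le> C * (B / m) * dist x y"
    proof -
      have sB: "norm (s y) \<le> B / m"
        using inv[OF xy(2), of "s y"] s[OF xy(2)] B(2)[OF xy(2)] m by (simp add: field_simps)
      have "Q x (s y) - Q y (s y) = (\<Sum>e\<in>Basis. (s y \<bullet> e) *\<^sub>R (Q x e - Q y e))"
        by (simp add: Qsum[OF xy(1), of "s y"] Qsum[OF xy(2), of "s y"] scaleR_diff_right sum_subtractf)
      also have "norm \<dots> \<le> (\<Sum>e\<in>Basis. (B / m) * (LQ e * dist x y))"
      proof (intro sum_norm_le)
        fix e :: 'b assume e: "e \<in> Basis"
        show "norm ((s y \<bullet> e) *\<^sub>R (Q x e - Q y e)) \<le> (B / m) * (LQ e * dist x y)"
          unfolding norm_scaleR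
          using order_trans[OF Basis_le_norm[OF e] sB] lipschitz_onD[OF LQ xy, of e] B(1) m
          by (intro mult_mono) (auto simp: dist_norm)
      qed
      also have "\<dots> = C * (B / m) * dist x y"
        by (simp add: C_def sum_distrib_left sum_distrib_right sum_divide_distrib mult_ac)
      finally show ?thesis .
    qed
    finally have "m * norm (s x - s y) \<le> (Lb + C * (B / m)) * dist x y" by (simp add: algebra_simps)
    then show "dist (s x) (s y) \<le> (Lb + C * (B / m)) / m * dist x y"
      using m by (simp add: dist_norm pos_le_divide_eq mult.commute)
  qed
  then show ?thesis by blast
qed

section \<open>Tangent spaces and Lipschitz frames of compact submanifolds\<close>

lemma tangent_space_subset_velocities:
  assumes "M \<subseteq> W"
  shows "tangent_space M x \<subseteq> velocities W x"
proof
  fix v assume "v \<in> tangent_space M x"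
  then obtain \<gamma> \<epsilon> where \<gamma>: "\<epsilon> > 0" "\<gamma> ` {-\<epsilon><..<\<epsilon>} \<subseteq> M" "\<gamma> 0 = x"
      "(\<gamma> has_vector_derivative v) (at 0)"
    unfolding tangent_space_def by auto
  have "\<forall>\<^sub>F t in nhds 0. t \<in> {-\<epsilon><..<\<epsilon>}"
    using \<gamma>(1) by (intro eventually_nhds_in_open) auto
  then have "\<forall>\<^sub>F t in nhds 0. \<gamma> t \<in> W"
    by (rule eventually_mono) (use \<gamma>(2) assms in blast)
  then show "v \<in> velocities W x" unfolding velocities_def using \<gamma> by auto
qed

lemma has_vector_derivative_compose:
  assumes "(\<gamma> has_vector_derivative v) (at t within S)" "(g has_derivative g') (at (\<gamma> t))"
  shows "((\<lambda>t. g (\<gamma> t)) has_vector_derivative g' v) (at t within S)"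
  using vector_derivative_diff_chain_within[OF assms(1) has_derivative_at_withinI[OF assms(2)]]
  by (simp add: o_def)

text \<open>A chart \<open>\<phi>\<close> with inverse \<open>\<psi>\<close> turns curves in \<open>W\<close> through \<open>x\<close> into curves in the linear space \<open>L\<close>, whose velocities stay in
  \<open>L\<close> because \<open>L\<close> is closed; conversely \<open>\<psi>\<close> maps straight lines in \<open>L\<close> to curves in \<open>W\<close>.\<close>

lemma velocities_chart:
  fixes W V L :: "'a::euclidean_space set"
  assumes open_: "open U" "open V" and hom: "homeomorphism U V \<phi> \<psi>"
    and L: "subspace L" "\<phi> ` (W \<inter> U) = L \<inter> V"
    and \<phi>': "\<And>x. x \<in> U \<Longrightarrow> (\<phi> has_derivative \<phi>' x) (at x)"
    and \<psi>': "\<And>y. y \<in> V \<Longrightarrow> (\<psi> has_derivative \<psi>' y) (at y)"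
    and x: "x \<in> W" "x \<in> U"
  shows "velocities W x = \<psi>' (\<phi> x) ` L"
proof (intro equalityI subsetI)
  have inv: "\<And>u. u \<in> U \<Longrightarrow> \<psi> (\<phi> u) = u" "\<And>u. u \<in> U \<Longrightarrow> \<phi> u \<in> V"
      "\<And>y. y \<in> V \<Longrightarrow> \<psi> y \<in> U" "\<And>y. y \<in> V \<Longrightarrow> \<phi> (\<psi> y) = y"
    using hom by (auto simp: homeomorphism_def)
  have WL: "\<psi> y \<in> W" if y: "y \<in> L" "y \<in> V" for y
  proof -
    have "y \<in> \<phi> ` (W \<inter> U)" using y L(2) by simp
    then show ?thesis using inv(1) by auto
  qed
  have \<phi>x: "\<phi> x \<in> L" "\<phi> x \<in> V" using L(2) x by auto
  {
    fix v assume "v \<in> velocities W x"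
    then obtain \<gamma> where \<gamma>: "\<gamma> 0 = x" "\<forall>\<^sub>F t in nhds 0. \<gamma> t \<in> W" "(\<gamma> has_vector_derivative v) (at 0)"
      by (auto simp: velocities_def)
    have "\<gamma> \<midarrow>0\<rightarrow> x"
      using has_vector_derivative_continuous[OF \<gamma>(3)] \<gamma>(1) by (simp add: isCont_def)
    then have "\<forall>\<^sub>F t in at 0. \<gamma> t \<in> U" using open_(1) x(2) by (rule topological_tendstoD)
    then have "\<forall>\<^sub>F t in nhds 0. \<gamma> t \<in> U" using \<gamma>(1) x by (simp add: eventually_nhds_conv_at)
    with \<gamma>(2) have ev: "\<forall>\<^sub>F t in nhds 0. \<gamma> t \<in> W \<and> \<gamma> t \<in> U" by eventually_elim auto
    define \<beta> where "\<beta> t = \<phi> (\<gamma> t)" for t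
    have \<beta>: "(\<beta> has_vector_derivative \<phi>' x v) (at 0)"
      unfolding \<beta>_def using has_vector_derivative_compose[OF \<gamma>(3)] \<phi>'[OF x(2)] \<gamma>(1) by simp
    have "\<phi>' x v \<in> closure L"
      unfolding closure_approachable
    proof (intro allI impI)
      fix \<epsilon> :: real assume \<epsilon>: "\<epsilon> > 0"
      obtain \<delta> where \<delta>: "\<delta> > 0" "\<And>t. \<bar>t\<bar> < \<delta> \<Longrightarrow> norm (\<beta> t - \<beta> 0 - t *\<^sub>R \<phi>' x v) \<le> \<epsilon>/2 * \<bar>t\<bar>"
        using vector_derivative_first_order[OF \<beta>, of "\<epsilon>/2"] \<epsilon> by auto
      obtain \<delta>' where \<delta>': "\<delta>' > 0" "\<And>t. \<bar>t\<bar> < \<delta>' \<Longrightarrow> \<gamma> t \<in> W \<inter> U"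
        using ev unfolding eventually_nhds_metric by (auto simp: dist_real_def)
      define t where "t = min \<delta> \<delta>' / 2"
      have t: "t > 0" "\<bar>t\<bar> < \<delta>" "\<bar>t\<bar> < \<delta>'" using \<delta>(1) \<delta>'(1) by (auto simp: t_def)
      have "\<beta> t \<in> L" "\<beta> 0 \<in> L"
        using L(2) \<delta>'(2)[OF t(3)] \<gamma>(1) \<phi>x by (auto simp: \<beta>_def)
      then have memL: "(1/t) *\<^sub>R (\<beta> t - \<beta> 0) \<in> L"
        using L(1) by (simp add: subspace_diff subspace_scale)
      have "(1/t) *\<^sub>R (\<beta> t - \<beta> 0) - \<phi>' x v = (1/t) *\<^sub>R (\<beta> t - \<beta> 0 - t *\<^sub>R \<phi>' x v)"
        using t(1) by (simp add: algebra_simps)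
      then have "dist ((1/t) *\<^sub>R (\<beta> t - \<beta> 0)) (\<phi>' x v) = (1/t) * norm (\<beta> t - \<beta> 0 - t *\<^sub>R \<phi>' x v)"
        using t(1) by (simp only: dist_norm norm_scaleR) simp
      also have "\<dots> \<le> (1/t) * (\<epsilon>/2 * t)"
        using \<delta>(2)[OF t(2)] t(1) by (intro mult_left_mono) auto
      finally have "dist ((1/t) *\<^sub>R (\<beta> t - \<beta> 0)) (\<phi>' x v) \<le> (1/t) * (\<epsilon>/2 * t)" .
      then show "\<exists>y\<in>L. dist y (\<phi>' x v) < \<epsilon>" using memL t(1) \<epsilon> by (intro bexI[OF _ memL]) simp
    qed
    then have \<phi>'L: "\<phi>' x v \<in> L"
      using closed_subspace[OF L(1)] by (simp add: closure_closed)
    have "((\<lambda>t. \<psi> (\<beta> t)) has_vector_derivative \<psi>' (\<phi> x) (\<phi>' x v)) (at 0)"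
      using has_vector_derivative_compose[OF \<beta>] \<psi>'[OF \<phi>x(2)] \<gamma>(1) by (simp add: \<beta>_def)
    moreover have "\<forall>\<^sub>F t in nhds 0. \<psi> (\<beta> t) = \<gamma> t"
      using ev by eventually_elim (simp add: \<beta>_def inv)
    ultimately have "(\<gamma> has_vector_derivative \<psi>' (\<phi> x) (\<phi>' x v)) (at 0)"
      using has_vector_derivative_cong_ev[of UNIV "\<lambda>t. \<psi> (\<beta> t)" \<gamma> 0] \<gamma>(1) x inv(1) by (simp add: \<beta>_def)
    then have "v = \<psi>' (\<phi> x) (\<phi>' x v)"
      using vector_derivative_unique_at[OF \<gamma>(3)] by blast
    then show "v \<in> \<psi>' (\<phi> x) ` L" using \<phi>'L by blast
  next
    fix v assume "v \<in> \<psi>' (\<phi> x) ` L"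
    then obtain l where l: "l \<in> L" "v = \<psi>' (\<phi> x) l" by auto
    define \<beta> where "\<beta> t = \<phi> x + t *\<^sub>R l" for t :: real
    have "(\<beta> has_vector_derivative l) (at 0)"
      unfolding \<beta>_def by (auto intro!: derivative_eq_intros)
    then have "((\<lambda>t. \<psi> (\<beta> t)) has_vector_derivative v) (at 0)"
      using has_vector_derivative_compose[of \<beta> l 0 UNIV] \<psi>'[OF \<phi>x(2)] by (simp add: \<beta>_def l(2))
    moreover have "\<psi> (\<beta> 0) = x" by (simp add: \<beta>_def inv x)
    moreover have "\<forall>\<^sub>F t in nhds 0. \<psi> (\<beta> t) \<in> W"
    proof -
      have "isCont \<beta> 0" unfolding \<beta>_def by (intro continuous_intros)
      then have "\<forall>\<^sub>F t in at 0. \<beta> t \<in> V"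
        using topological_tendstoD[of \<beta> "\<phi> x" "at 0" V] open_(2) \<phi>x by (simp add: isCont_def \<beta>_def)
      then have "\<forall>\<^sub>F t in nhds 0. \<beta> t \<in> V" using \<phi>x by (simp add: eventually_nhds_conv_at \<beta>_def)
      then show ?thesis
      proof eventually_elim
        case (elim t)
        have "\<beta> t \<in> L" using L(1) \<phi>x l by (simp add: \<beta>_def subspace_add subspace_scale)
        then show ?case using WL elim by blast
      qed
    qed
    ultimately show "v \<in> velocities W x"
      unfolding velocities_def mem_Collect_eq by (intro exI[of _ "\<lambda>t. \<psi> (\<beta> t)"] conjI)
  }
qed

text \<open>Near \<open>x0\<close> the images of a basis of \<open>L\<close> under the derivative of the inverse chart \<open>\<psi>\<close> form a frame; it is
  Lipschitz because \<open>\<psi>\<close> is \<open>C\<^sup>2\<close>.\<close>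

lemma local_lipschitz_frame:
  fixes W :: "'a::euclidean_space set"
  assumes "smooth_submanifold d W" "x0 \<in> W"
  obtains r and B :: "'a set" and e where "r > 0" "finite B" "\<And>b. b \<in> B \<Longrightarrow> lip (cball x0 r) (e b)"
    "\<And>x. x \<in> W \<Longrightarrow> dist x0 x \<le> r \<Longrightarrow> velocities W x = span ((\<lambda>b. e b x) ` B)"
proof -
  have "\<exists>U V \<phi> \<psi> (L :: 'a set). open U \<and> x0 \<in> U \<and> open V \<and> homeomorphism U V \<phi> \<psi> \<and> Cinf_on U \<phi> \<and>
      Cinf_on V \<psi> \<and> subspace L \<and> dim L = d \<and> \<phi> ` (W \<inter> U) = L \<inter> V"
    using assms(1)[unfolded smooth_submanifold_def] assms(2) by (rule bspec)
  then obtain U V \<phi> \<psi> and L :: "'a set" where chart: "open U" "x0 \<in> U" "open V" "homeomorphism U V \<phi> \<psi>"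
      "Cinf_on U \<phi>" "Cinf_on V \<psi>" "subspace L" "\<phi> ` (W \<inter> U) = L \<inter> V"
    by (elim exE conjE) (rule that, assumption+)
  obtain \<phi>' where \<phi>': "\<And>x. x \<in> U \<Longrightarrow> (\<phi> has_derivative \<phi>' x) (at x)"
    using chart(5) unfolding Cinf_on_def by (metis Ck_on.simps(2))
  have "Ck_on (Suc 1) V \<psi>" using chart(6) unfolding Cinf_on_def by blast
  then obtain \<psi>' where \<psi>': "\<And>x. x \<in> V \<Longrightarrow> (\<psi> has_derivative \<psi>' x) (at x)"
      "\<And>v. Ck_on 1 V (\<lambda>x. \<psi>' x v)"
    unfolding Ck_on.simps by metis
  obtain B where "B \<subseteq> L" "independent B" "L \<subseteq> span B" by (rule basis_exists)
  then have B: "finite B" "span B = L"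
    using span_subspace[OF _ _ chart(7)] independent_imp_finite by simp_all
  define e where "e b x = \<psi>' (\<phi> x) b" for b x
  have \<phi>x0: "\<phi> x0 \<in> V" using chart(2,4) by (auto simp: homeomorphism_def)
  obtain s where s: "s > 0" "cball (\<phi> x0) s \<subseteq> V" using chart(3) \<phi>x0 open_contains_cball by blast
  obtain r1 where r1: "r1 > 0" "cball x0 r1 \<subseteq> U" using chart(1,2) open_contains_cball by blast
  have "Ck_on 1 U \<phi>" using chart(5) unfolding Cinf_on_def by blast
  then obtain M where M: "M-lipschitz_on (cball x0 r1) \<phi>"
    using C1_lip_compact_convex[OF _ r1(2) compact_cball convex_cball] by blast
  have M0: "M \<ge> 0" using lipschitz_on_nonneg[OF M] .
  define r where "r = min r1 (s / (M + 1))"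
  have r: "r > 0" "r \<le> r1" using r1 s M0 by (auto simp: r_def)
  have "\<phi> x \<in> cball (\<phi> x0) s" if "x \<in> cball x0 r" for x
  proof -
    have "dist (\<phi> x0) (\<phi> x) \<le> M * dist x0 x"
      using lipschitz_onD[OF M, of x0 x] that r by auto
    also have "\<dots> \<le> (M + 1) * (s / (M + 1))"
      using that M0 s by (intro mult_mono) (auto simp: r_def)
    finally show ?thesis using M0 by simp
  qed
  then have img: "\<phi> ` cball x0 r \<subseteq> cball (\<phi> x0) s" by blast
  have "lip (cball x0 r) (e b)" for b
  proof -
    obtain C where C: "C-lipschitz_on (cball (\<phi> x0) s) (\<lambda>x. \<psi>' x b)"
      using C1_lip_compact_convex[OF \<psi>'(2) s(2) compact_cball convex_cball] by blast
    have "M-lipschitz_on (cball x0 r) \<phi>" by (rule lipschitz_on_subset[OF M subset_cball[OF r(2)]])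
    then have "(C * M)-lipschitz_on (cball x0 r) (e b)"
      unfolding e_def using lipschitz_on_compose2[OF _ lipschitz_on_subset[OF C img]] by blast
    then show ?thesis by blast
  qed
  moreover have "velocities W x = span ((\<lambda>b. e b x) ` B)" if x: "x \<in> W" "dist x0 x \<le> r" for x
  proof -
    have xU: "x \<in> U" using r r1 x by auto
    then have "\<phi> x \<in> V" using chart(4) by (auto simp: homeomorphism_def)
    then have lin: "linear (\<psi>' (\<phi> x))" using \<psi>'(1) has_derivative_linear by blast
    have "velocities W x = \<psi>' (\<phi> x) ` span B"
      using velocities_chart[OF chart(1,3,4,7,8) \<phi>' \<psi>'(1) x(1) xU] B by simp
    also have "\<dots> = span (\<psi>' (\<phi> x) ` B)" using linear_span_image[OF lin] by simp
    finally show ?thesis by (simp add: e_def)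
  qed
  ultimately show thesis using that[OF r(1) B(1)] by blast
qed

lemma subspace_velocities:
  assumes "smooth_submanifold d W" "x \<in> W"
  shows "subspace (velocities W x)"
proof (rule local_lipschitz_frame[OF assms])
  fix r :: real and B :: "'a set" and e :: "'a \<Rightarrow> 'a \<Rightarrow> 'a"
  assume "r > 0" and "\<And>y. y \<in> W \<Longrightarrow> dist x y \<le> r \<Longrightarrow> velocities W y = span ((\<lambda>b. e b y) ` B)"
  then have "velocities W x = span ((\<lambda>b. e b x) ` B)" using assms(2) by simp
  then show ?thesis by simp
qed

text \<open>Finitely many local frames, cut off by the tent functions \<open>\<rho> p\<close> of a finite cover by balls. At each point some
  tent is positive, so the fields still span; no normalization to a partition of unity is required. The fields are indexed by the
  centre of the ball and the basis vector.\<close>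

lemma lipschitz_frame:
  fixes W :: "'a::euclidean_space set"
  assumes W: "compact W" "smooth_submanifold d W"
  obtains I :: "('a \<times> 'a) set" and Y where "finite I" "\<And>j. j \<in> I \<Longrightarrow> lip W (Y j)"
    "\<And>x. x \<in> W \<Longrightarrow> velocities W x = span ((\<lambda>j. Y j x) ` I)"
proof -
  have "\<forall>p\<in>W. \<exists>r (B :: 'a set) e. r > 0 \<and> finite B \<and> (\<forall>b\<in>B. lip (cball p r) (e b)) \<and>
      (\<forall>x\<in>W. dist p x \<le> r \<longrightarrow> velocities W x = span ((\<lambda>b. e b x) ` B))"
  proof
    fix p assume p: "p \<in> W"
    show "\<exists>r (B :: 'a set) e. r > 0 \<and> finite B \<and> (\<forall>b\<in>B. lip (cball p r) (e b)) \<and>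
      (\<forall>x\<in>W. dist p x \<le> r \<longrightarrow> velocities W x = span ((\<lambda>b. e b x) ` B))"
      by (rule local_lipschitz_frame[OF W(2) p]) blast
  qed
  from bchoice[OF this] obtain r where "\<forall>p\<in>W. \<exists>(B :: 'a set) e. r p > 0 \<and> finite B \<and>
      (\<forall>b\<in>B. lip (cball p (r p)) (e b)) \<and>
      (\<forall>x\<in>W. dist p x \<le> r p \<longrightarrow> velocities W x = span ((\<lambda>b. e b x) ` B))" ..
  from bchoice[OF this] obtain B :: "'a \<Rightarrow> 'a set" where "\<forall>p\<in>W. \<exists>e. r p > 0 \<and> finite (B p) \<and>
      (\<forall>b\<in>B p. lip (cball p (r p)) (e b)) \<and>
      (\<forall>x\<in>W. dist p x \<le> r p \<longrightarrow> velocities W x = span ((\<lambda>b. e b x) ` B p))" ..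
  from bchoice[OF this] obtain e where "\<forall>p\<in>W. r p > 0 \<and> finite (B p) \<and>
      (\<forall>b\<in>B p. lip (cball p (r p)) (e p b)) \<and>
      (\<forall>x\<in>W. dist p x \<le> r p \<longrightarrow> velocities W x = span ((\<lambda>b. e p b x) ` B p))" ..
  then have loc: "\<And>p. p \<in> W \<Longrightarrow> r p > 0" "\<And>p. p \<in> W \<Longrightarrow> finite (B p)"
      "\<And>p b. p \<in> W \<Longrightarrow> b \<in> B p \<Longrightarrow> lip (cball p (r p)) (e p b)"
      "\<And>p x. p \<in> W \<Longrightarrow> x \<in> W \<Longrightarrow> dist p x \<le> r p \<Longrightarrow> velocities W x = span ((\<lambda>b. e p b x) ` B p)"
    by blast+
  have cover: "W \<subseteq> (\<Union>p\<in>W. ball p (r p))" using loc(1) by force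
  obtain C where C: "C \<subseteq> W" "finite C" "W \<subseteq> (\<Union>p\<in>C. ball p (r p))"
    by (rule compactE_image[OF W(1) open_ball cover]) blast
  define \<rho> where "\<rho> p x = max 0 (r p - dist p x)" for p x
  define Y where "Y j x = \<rho> (fst j) x *\<^sub>R e (fst j) (snd j) x" for j x
  define I where "I = (SIGMA p:C. B p)"
  have "finite I" unfolding I_def using C loc(2) by auto
  moreover have "lip W (Y j)" if j: "j \<in> I" for j
  proof -
    obtain p b where pb: "j = (p, b)" "p \<in> C" "b \<in> B p" using j by (auto simp: I_def)
    have pW: "p \<in> W" using C pb by auto
    have "1-lipschitz_on W (\<rho> p)"
      using dist_triangle[of p] dist_triangle2[of p]
      by (intro lipschitz_onI)
        (auto simp: \<rho>_def dist_real_def max_def abs_le_iff algebra_simps, (smt (verit) dist_commute dist_triangle)+)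
    then have "lip W (\<lambda>x. \<rho> p x *\<^sub>R e p b x)"
    proof (intro lip_scaleR_cutoff[OF W(1), of _ "W \<inter> cball p (r p)"])
      show "lip (W \<inter> cball p (r p)) (e p b)"
        using loc(3)[OF pW pb(3)] lipschitz_on_subset by (metis inf_le2)
    qed (auto simp: \<rho>_def W(1) compact_Int_closed)
    then show ?thesis by (simp add: Y_def pb(1))
  qed
  moreover have "velocities W x = span ((\<lambda>j. Y j x) ` I)" if x: "x \<in> W" for x
  proof
    obtain p where p: "p \<in> C" "x \<in> ball p (r p)" using C(3) x by auto
    then have \<rho>p: "\<rho> p x > 0" by (simp add: \<rho>_def)
    have vp: "velocities W x = span ((\<lambda>b. e p b x) ` B p)"
      using loc(4)[of p x] p C(1) x by auto
    show "velocities W x \<subseteq> span ((\<lambda>j. Y j x) ` I)"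
      unfolding vp
    proof (rule span_minimal; clarify?)
      fix b assume "b \<in> B p"
      then have "Y (p, b) x \<in> span ((\<lambda>j. Y j x) ` I)"
        using p by (intro span_base) (auto simp: I_def)
      then have "(1 / \<rho> p x) *\<^sub>R Y (p, b) x \<in> span ((\<lambda>j. Y j x) ` I)" by (rule span_scale)
      then show "e p b x \<in> span ((\<lambda>j. Y j x) ` I)" using \<rho>p by (simp add: Y_def)
    qed
    show "span ((\<lambda>j. Y j x) ` I) \<subseteq> velocities W x"
    proof (rule span_minimal; clarify?)
      show "subspace (velocities W x)" unfolding vp by simp
      fix q b assume qb: "(q, b) \<in> I"
      show "Y (q, b) x \<in> velocities W x"
      proof (cases "dist q x \<le> r q")
        case True
        have "velocities W x = span ((\<lambda>b. e q b x) ` B q)"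
          using loc(4)[of q x] True qb x C(1) by (auto simp: I_def)
        moreover have "e q b x \<in> span ((\<lambda>b. e q b x) ` B q)"
          using qb by (intro span_base) (auto simp: I_def)
        ultimately show ?thesis by (simp add: Y_def span_scale)
      next
        case False
        then show ?thesis unfolding vp by (simp add: Y_def \<rho>_def span_zero)
      qed
    qed
  qed
  ultimately show thesis using that by blast
qed

section \<open>Consequences of Conditions (a) and (b)\<close>

text \<open>The closure of the critical points off \<open>V(F)\<close> is compact and misses \<open>V(F)\<close>, so \<open>\<parallel>F\<parallel>\<close> has a positive minimum
  on it.\<close>

lemma condition_a_gap:
  fixes F :: "'a::euclidean_space \<Rightarrow> 'b::euclidean_space"
  assumes "compact W" "continuous_on W F" "condition_a W F"
  obtains \<epsilon> where "\<epsilon> > 0"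
    "\<And>x. x \<in> W \<Longrightarrow> F x \<noteq> 0 \<Longrightarrow> norm (F x) < \<epsilon> \<Longrightarrow> x \<notin> critical_points DIM('b) W F"
proof -
  define C where "C = closure (critical_points DIM('b) W F - zeros_in W F)"
  have CW: "C \<subseteq> W"
    unfolding C_def by (rule closure_minimal) (use assms(1) compact_imp_closed in \<open>auto simp: critical_points_def\<close>)
  then have C: "compact C"
    using assms(1) closed_closure compact_Int_closed by (metis C_def inf.absorb_iff2)
  have nz: "F x \<noteq> 0" if "x \<in> C" for x
    using that CW assms(3) unfolding condition_a_def C_def zeros_in_def by blast
  have inC: "x \<in> C" if "x \<in> critical_points DIM('b) W F" "F x \<noteq> 0" for x
  proof -
    have "x \<in> critical_points DIM('b) W F - zeros_in W F" using that by (simp add: zeros_in_def)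
    then show ?thesis unfolding C_def by (rule subsetD[OF closure_subset])
  qed
  show thesis
  proof (cases "C = {}")
    case True
    then show thesis
      using that[of 1] inC by auto
  next
    case False
    have "continuous_on C (\<lambda>x. norm (F x))"
      by (intro continuous_intros continuous_on_subset[OF assms(2) CW])
    then obtain x0 where x0: "x0 \<in> C" "\<And>x. x \<in> C \<Longrightarrow> norm (F x0) \<le> norm (F x)"
      using continuous_attains_inf[OF C False] by blast
    show thesis
    proof (rule that[of "norm (F x0)"])
      show "norm (F x0) > 0" using nz x0(1) by simp
      fix x assume x: "x \<in> W" "F x \<noteq> 0" "norm (F x) < norm (F x0)"
      show "x \<notin> critical_points DIM('b) W F"
      proof
        assume "x \<in> critical_points DIM('b) W F"
        then have "x \<in> C" using inC x(2) by simp
        then show False using x0(2) x(3) by fastforce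
      qed
    qed
  qed
qed

text \<open>In this form regularity of \<open>F\<close> says that \<open>F'\<close> composed with its adjoint, relative to the tangent space, is
  positive definite.\<close>

lemma regular_point_orthogonal:
  fixes F :: "'a::euclidean_space \<Rightarrow> 'b::euclidean_space"
  assumes F': "(F has_derivative F') (at x)"
    and x: "x \<in> W" "x \<notin> critical_points DIM('b) W F"
    and w: "\<And>v. v \<in> velocities W x \<Longrightarrow> w \<bullet> F' v = 0"
  shows "w = 0"
proof (rule ccontr)
  assume "w \<noteq> 0"
  have "frechet_derivative F (at x) = F'" using F' frechet_derivative_at by metis
  then have "DIM('b) \<le> dim (F' ` tangent_space W x)"
    using x by (simp add: critical_points_def)
  also have "\<dots> \<le> dim {u. w \<bullet> u = 0}"
    by (rule dim_subset) (use w tangent_space_subset_velocities[of W W x] in auto)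
  also have "\<dots> = DIM('b) - 1" using dim_hyperplane[OF \<open>w \<noteq> 0\<close>] .
  finally show False using DIM_positive[where 'a='b] by linarith
qed

text \<open>The radial component of \<open>F'\<close> is removed and the rest divided by \<open>\<parallel>F x\<parallel>\<close>.\<close>

lemma normalized_has_derivative:
  assumes F': "(F has_derivative F') (at x)" and nz: "F x \<noteq> 0"
  shows "(normalized F has_derivative
    (\<lambda>v. (1 / norm (F x)) *\<^sub>R F' v - ((F x \<bullet> F' v) / norm (F x) ^ 3) *\<^sub>R F x)) (at x)"
proof -
  have "((\<lambda>x. norm (F x)) has_derivative (\<lambda>v. F' v \<bullet> sgn (F x))) (at x)"
    using has_derivative_compose[OF F' has_derivative_norm[OF nz]] .
  then have "((\<lambda>x. inverse (norm (F x))) has_derivative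
      (\<lambda>v. - (inverse (norm (F x)) * (F' v \<bullet> sgn (F x)) * inverse (norm (F x))))) (at x)"
    by (intro Deriv.has_derivative_inverse) (use nz in simp_all)
  from has_derivative_scaleR[OF this F'] show ?thesis
    unfolding normalized_def[abs_def]
    by (rule has_derivative_eq_rhs)
      (use nz in \<open>auto simp: fun_eq_iff sgn_div_norm inner_commute power3_eq_cube field_simps\<close>)
qed

text \<open>The image of the differential of \<open>F / \<parallel>F\<parallel>\<close> is orthogonal to \<open>F x\<close>. If it were also orthogonal to a further
  nonzero vector \<open>w\<close> that is perpendicular to \<open>F x\<close>, its dimension would be at most \<open>DIM('b) - 2\<close>.\<close>

lemma condition_b_orthogonal:
  fixes F :: "'a::euclidean_space \<Rightarrow> 'b::euclidean_space"
  assumes F': "(F has_derivative F') (at x)" and b: "condition_b W F"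
    and x: "x \<in> W" "F x \<noteq> 0" and wF: "w \<bullet> F x = 0"
    and w: "\<And>v. v \<in> velocities W x \<Longrightarrow> w \<bullet> F' v = 0"
  shows "w = 0"
proof (rule ccontr)
  assume w0: "w \<noteq> 0"
  let ?D = "\<lambda>v. (1 / norm (F x)) *\<^sub>R F' v - ((F x \<bullet> F' v) / norm (F x) ^ 3) *\<^sub>R F x"
  let ?T = "tangent_space (W - zeros_in W F) x"
  let ?A = "span {F x, w}"
  have "frechet_derivative (normalized F) (at x) = ?D"
    using frechet_derivative_at[OF normalized_has_derivative[OF F' x(2)]] by simp
  moreover have "x \<in> W - zeros_in W F" using x by (auto simp: zeros_in_def)
  ultimately have "DIM('b) - 1 \<le> dim (?D ` ?T)"
    using b unfolding condition_b_def critical_points_def by (auto simp: not_less)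
  also have "\<dots> \<le> dim {y \<in> UNIV. \<forall>u\<in>?A. orthogonal u y}"
  proof (intro dim_subset image_subsetI CollectI conjI UNIV_I ballI)
    fix v u assume v: "v \<in> ?T" and u: "u \<in> ?A"
    have "v \<in> velocities W x" using tangent_space_subset_velocities v by blast
    then have "w \<bullet> ?D v = 0" using w wF by (simp add: inner_diff_right)
    moreover have "F x \<bullet> ?D v = 0"
      using x(2) by (simp add: inner_diff_right power3_eq_cube dot_square_norm power2_eq_square)
    moreover have "orthogonal y u" if "w \<bullet> y = 0" "F x \<bullet> y = 0" for y
      by (rule orthogonal_to_span[OF u]) (use that in \<open>auto simp: orthogonal_def inner_commute\<close>)
    ultimately have "orthogonal (?D v) u" by blast
    then show "orthogonal u (?D v)" by (simp add: orthogonal_commute)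
  qed
  finally have le: "DIM('b) - 1 \<le> dim {y \<in> UNIV. \<forall>u\<in>?A. orthogonal u y}" .
  have "dim {y \<in> UNIV. \<forall>u\<in>?A. orthogonal u y} + dim ?A = dim (UNIV :: 'b set)"
    by (rule dim_subspace_orthogonal_to_vectors) auto
  moreover have "dim ?A = 2"
  proof -
    have "pairwise orthogonal {F x, w}"
      using wF by (auto simp: pairwise_def orthogonal_def inner_commute)
    then have "independent {F x, w}"
      by (rule pairwise_orthogonal_independent) (use x(2) w0 in auto)
    then have "dim {F x, w} = card {F x, w}" by (rule dim_eq_card_independent)
    moreover have "F x \<noteq> w" using wF w0 by auto
    ultimately show ?thesis by (simp add: dim_span)
  qed
  ultimately show False using le by simp
qed

section \<open>Lifting rotations of the sphere\<close>

text \<open>With \<open>Z j = dF(Y j)\<close> look for \<open>X = (\<Sum>j. (s \<bullet> Z j) Y j)\<close>, so that \<open>dF(X) = (\<Sum>j. (s \<bullet> Z j) Z j)\<close>. The operator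
  \<open>Q w = (\<Sum>j. (w \<bullet> Z j) Z j) + c (w \<bullet> F) F\<close> with \<open>c \<ge> 0\<close> is symmetric and positive semidefinite, and \<open>Q w = 0\<close> means that \<open>w\<close>
  is orthogonal to the image of \<open>dF\<close> and, if \<open>c > 0\<close>, also to \<open>F\<close>. Condition (b) excludes this where \<open>c > 0\<close>, and
  Condition (a) excludes it near \<open>V(F)\<close> even where \<open>c = 0\<close>. So \<open>Q s = A F\<close> has a unique solution,
  and \<open>dF(X) = A F - c (s \<bullet> F) F\<close>.

  Towards \<open>V(F)\<close> the field may be unbounded, which is why it is Lipschitz only on the sets \<open>r \<le> \<parallel>F\<parallel>\<close>.\<close>

lemma lifted_vector_field:
  fixes F :: "'a::euclidean_space \<Rightarrow> 'b::euclidean_space" and A :: "'b \<Rightarrow> 'b"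
  assumes W: "compact W" "smooth_submanifold d W" and F: "Ck_on 2 UNIV F"
    and F': "\<And>x. (F has_derivative F' x) (at x)"
    and ab: "condition_a W F" "condition_b W F" and A: "linear A"
  obtains X \<epsilon> where "\<epsilon> > 0" "\<And>r. r > 0 \<Longrightarrow> lip {x \<in> W. r \<le> norm (F x)} X"
    "\<And>x. x \<in> W \<Longrightarrow> F x \<noteq> 0 \<Longrightarrow> X x \<in> velocities W x"
    "\<And>x. x \<in> W \<Longrightarrow> F x \<noteq> 0 \<Longrightarrow> \<exists>l. F' x (X x) = A (F x) + l *\<^sub>R F x \<and> (norm (F x) \<le> \<epsilon> \<longrightarrow> l = 0)"
proof -
  have F2: "Ck_on (Suc 1) UNIV F" using F by (simp only: numeral_2_eq_2 One_nat_def)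
  then obtain Fd where "\<forall>x\<in>UNIV. (F has_derivative Fd x) (at x)" "\<forall>v. Ck_on 1 UNIV (\<lambda>x. Fd x v)"
    unfolding Ck_on.simps(2) by blast
  then have Fd: "\<And>x. (F has_derivative Fd x) (at x)" "\<And>v. Ck_on 1 UNIV (\<lambda>x. Fd x v)"
    by blast+
  have FdF': "Fd x = F' x" for x using has_derivative_unique[OF Fd(1) F'] .
  have F1: "Ck_on 1 UNIV F" using Ck_on_pred[OF F2] .
  have lipF: "lip W F" and lipF': "lip W (\<lambda>x. F' x v)" for v
    using C1_lip_compact[OF F1 W(1)] C1_lip_compact[OF Fd(2) W(1)] unfolding FdF' by blast+
  have contF: "continuous_on W F" using lip_continuous_on[OF lipF] .
  obtain \<epsilon> where \<epsilon>: "\<epsilon> > 0"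
      "\<And>x. x \<in> W \<Longrightarrow> F x \<noteq> 0 \<Longrightarrow> norm (F x) < \<epsilon> \<Longrightarrow> x \<notin> critical_points DIM('b) W F"
    by (rule condition_a_gap[OF W(1) contF ab(1)]) blast
  obtain I :: "('a \<times> 'a) set" and Y where Y: "finite I" "\<And>j. j \<in> I \<Longrightarrow> lip W (Y j)"
    "\<And>x. x \<in> W \<Longrightarrow> velocities W x = span ((\<lambda>j. Y j x) ` I)"
    by (rule lipschitz_frame[OF W]) blast
  have linF': "linear (F' x)" for x using F' has_derivative_linear by blast
  define Z where "Z j x = F' x (Y j x)" for j x
  \<comment> \<open>Zero where \<open>\<parallel>F\<parallel> \<le> \<epsilon>/2\<close>, and positive
    already before \<open>\<parallel>F\<parallel>\<close> reaches the bound \<open>\<epsilon>\<close> up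
    to which \<open>F\<close> is known to be regular.\<close>
  define c where "c x = max 0 (norm (F x) - \<epsilon>/2)" for x
  define Q where "Q x w = (\<Sum>j\<in>I. (w \<bullet> Z j x) *\<^sub>R Z j x) + (c x * (w \<bullet> F x)) *\<^sub>R F x" for x w
  have lipZ: "lip W (Z j)" if j: "j \<in> I" for j
  proof -
    have "lip W (\<lambda>x. \<Sum>b\<in>Basis. (Y j x \<bullet> b) *\<^sub>R F' x b)"
      using lip_linear[OF bounded_linear_inner_left Y(2)[OF j]]
      by (intro lip_sum lip_scaleR W(1) lipF')
    moreover have "(\<lambda>x. \<Sum>b\<in>Basis. (Y j x \<bullet> b) *\<^sub>R F' x b) = Z j"
    proof
      fix x
      interpret linear "F' x" using linF' .
      show "(\<Sum>b\<in>Basis. (Y j x \<bullet> b) *\<^sub>R F' x b) = Z j x"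
        unfolding Z_def
        by (subst (2) euclidean_representation[of "Y j x", symmetric]) (simp only: sum scale)
    qed
    ultimately show ?thesis by (simp only:)
  qed
  have lipc: "lip W c"
    unfolding c_def by (rule lip_compose_norm[OF lipF, of "\<lambda>s. max 0 (s - \<epsilon>/2)"]) linarith
  have lipQ: "lip W (\<lambda>x. Q x w)" for w
  proof -
    have const: "lip W (\<lambda>x. w)" using lipschitz_on_constant by blast
    have "lip W (\<lambda>x. (\<Sum>j\<in>I. (w \<bullet> Z j x) *\<^sub>R Z j x) + c x *\<^sub>R ((w \<bullet> F x) *\<^sub>R F x))"
      by (intro lip_add lip_sum lip_scaleR lip_inner W(1) lipZ lipc lipF const)
    then show ?thesis by (simp add: Q_def)
  qed
  have linQ: "linear (Q x)" for x
    unfolding Q_def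
    by (auto intro!: linearI simp: algebra_simps inner_add_left sum.distrib scaleR_sum_right)
  have posQ: "w \<bullet> Q x w > 0" if x: "x \<in> W" "F x \<noteq> 0" and w: "w \<noteq> 0" for x w
  proof (rule ccontr)
    have wQ: "w \<bullet> Q x w = (\<Sum>j\<in>I. (w \<bullet> Z j x)\<^sup>2) + c x * (w \<bullet> F x)\<^sup>2"
      by (simp add: Q_def inner_add_right inner_sum_right power2_eq_square)
    assume "\<not> w \<bullet> Q x w > 0"
    moreover have ge: "(\<Sum>j\<in>I. (w \<bullet> Z j x)\<^sup>2) \<ge> 0" "c x * (w \<bullet> F x)\<^sup>2 \<ge> 0"
      by (auto intro!: sum_nonneg simp: c_def)
    ultimately have zero: "(\<Sum>j\<in>I. (w \<bullet> Z j x)\<^sup>2) = 0" "c x * (w \<bullet> F x)\<^sup>2 = 0"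
      unfolding wQ by linarith+
    from zero(1) have wZ: "w \<bullet> Z j x = 0" if "j \<in> I" for j
      using that Y(1) by (simp add: sum_nonneg_eq_0_iff)
    have wv: "w \<bullet> F' x v = 0" if v: "v \<in> velocities W x" for v
    proof -
      have "subspace {v. w \<bullet> F' x v = 0}"
        using linear_subspace_vimage[OF linF' subspace_hyperplane[of w]] by (simp add: vimage_def)
      then have "span ((\<lambda>j. Y j x) ` I) \<subseteq> {v. w \<bullet> F' x v = 0}"
        using wZ by (intro span_minimal) (auto simp: Z_def)
      then show ?thesis using v Y(3)[OF x(1)] by auto
    qed
    have "w = 0"
    proof (cases "c x = 0")
      case True
      then have "norm (F x) < \<epsilon>" using \<epsilon>(1) by (simp add: c_def)
      then show ?thesis using regular_point_orthogonal[OF F' x(1) \<epsilon>(2)[OF x] wv] by simp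
    next
      case False
      then have "w \<bullet> F x = 0" using zero(2) by simp
      then show ?thesis using condition_b_orthogonal[OF F' ab(2) x _ wv] by simp
    qed
    then show False using w by simp
  qed
  have "\<exists>s. Q x s = A (F x)" if x: "x \<in> W" "F x \<noteq> 0" for x
  proof -
    have "inj (Q x)"
      unfolding linear_injective_0[OF linQ] using posQ[OF x] by fastforce
    then have "surj (Q x)" by (rule linear_inj_imp_surj[OF linQ])
    then show ?thesis by (metis surjD)
  qed
  then obtain s where s: "\<And>x. x \<in> W \<Longrightarrow> F x \<noteq> 0 \<Longrightarrow> Q x (s x) = A (F x)" by metis
  define X where "X x = (\<Sum>j\<in>I. (s x \<bullet> Z j x) *\<^sub>R Y j x)" for x
  show thesis
  proof (rule that[of "\<epsilon>/2" X])
    show "\<epsilon>/2 > 0" using \<epsilon> by simp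
  next
    fix r :: real assume r: "r > 0"
    let ?K = "{x \<in> W. r \<le> norm (F x)}"
    have sub: "?K \<subseteq> W" by auto
    note lipK = lip_subset[OF _ sub]
    have "closed ?K"
      using compact_imp_closed[OF W(1)] continuous_on_norm[OF contF]
      by (intro continuous_on_closed_Collect_le) auto
    then have K: "compact ?K" using W(1) sub by (metis compact_Int_closed inf.absorb_iff2)
    have "lip ?K s"
    proof (rule lip_solution_of_definite_system[OF K, of Q "\<lambda>x. A (F x)"])
      show "lip ?K (\<lambda>x. A (F x))"
        by (rule lip_linear[OF linear_conv_bounded_linear[THEN iffD1, OF A] lipK[OF lipF]])
      show "linear (Q x)" for x by (rule linQ)
      show "lip ?K (\<lambda>x. Q x w)" for w by (rule lipK[OF lipQ])
      fix x assume "x \<in> ?K"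
      then have x: "x \<in> W" "F x \<noteq> 0" using r by auto
      show "Q x (s x) = A (F x)" by (rule s[OF x])
      show "w \<noteq> 0 \<Longrightarrow> w \<bullet> Q x w > 0" for w by (rule posQ[OF x])
    qed
    then show "lip ?K X"
      unfolding X_def by (intro lip_sum lip_scaleR lip_inner K lipK[OF lipZ] lipK[OF Y(2)])
  next
    fix x assume x: "x \<in> W" "F x \<noteq> 0"
    show "X x \<in> velocities W x"
      unfolding Y(3)[OF x(1)] X_def by (intro span_sum span_scale span_base) auto
    interpret linear "F' x" using linF' .
    have "F' x (X x) = (\<Sum>j\<in>I. (s x \<bullet> Z j x) *\<^sub>R Z j x)" by (simp add: X_def Z_def sum scale)
    also have "\<dots> = A (F x) + (- c x * (s x \<bullet> F x)) *\<^sub>R F x"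
      using s[OF x] by (simp add: Q_def algebra_simps)
    finally show "\<exists>l. F' x (X x) = A (F x) + l *\<^sub>R F x \<and> (norm (F x) \<le> \<epsilon>/2 \<longrightarrow> l = 0)"
      by (intro exI[of _ "- c x * (s x \<bullet> F x)"]) (auto simp: c_def)
  qed
qed

text \<open>The generator of the rotations of the plane spanned by the orthonormal vectors \<open>u\<close> and \<open>v\<close>, extended by
  zero to the orthogonal complement.\<close>

definition rotation_generator :: "'b::real_inner \<Rightarrow> 'b \<Rightarrow> 'b \<Rightarrow> 'b" where
  "rotation_generator u v y = (y \<bullet> u) *\<^sub>R v - (y \<bullet> v) *\<^sub>R u"

lemma linear_rotation_generator: "linear (rotation_generator u v)"
  by (auto intro!: linearI simp: rotation_generator_def inner_add_left algebra_simps)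

lemma rotation_generator_skew: "y \<bullet> rotation_generator u v y = 0"
  by (simp add: rotation_generator_def inner_diff_right inner_commute)

definition circle_point :: "'b::real_vector \<Rightarrow> 'b \<Rightarrow> real \<Rightarrow> 'b" where
  "circle_point u v t = cos t *\<^sub>R u + sin t *\<^sub>R v"

lemma norm_circle_point:
  assumes "norm u = 1" "norm v = 1" "u \<bullet> v = 0"
  shows "norm (circle_point u v t) = 1"
proof -
  have "u \<bullet> u = 1" "v \<bullet> v = 1" "v \<bullet> u = 0"
    using assms by (simp_all add: dot_square_norm inner_commute)
  then have "circle_point u v t \<bullet> circle_point u v t = (cos t)\<^sup>2 + (sin t)\<^sup>2"
    using assms(3) by (simp add: circle_point_def inner_add_left inner_add_right power2_eq_square)
  then show ?thesis by (simp add: norm_eq_sqrt_inner)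
qed

lemma circle_point_has_derivative:
  assumes "norm u = 1" "norm v = 1" "u \<bullet> v = 0"
  shows "((\<lambda>t. circle_point u v (\<theta> + t * a)) has_vector_derivative
    a *\<^sub>R rotation_generator u v (circle_point u v (\<theta> + t * a))) (at t within S)"
proof -
  have *: "u \<bullet> u = 1" "v \<bullet> v = 1" "v \<bullet> u = 0"
    using assms by (simp_all add: dot_square_norm inner_commute)
  have "((\<lambda>t. circle_point u v (\<theta> + t * a)) has_vector_derivative
      (- sin (\<theta> + t * a) * a) *\<^sub>R u + (cos (\<theta> + t * a) * a) *\<^sub>R v) (at t within S)"
    unfolding circle_point_def
    by (auto intro!: derivative_eq_intros has_vector_derivative_scaleR
        simp flip: has_real_derivative_iff_has_vector_derivative)
  moreover have "(- sin (\<theta> + t * a) * a) *\<^sub>R u + (cos (\<theta> + t * a) * a) *\<^sub>R v =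
      a *\<^sub>R rotation_generator u v (circle_point u v (\<theta> + t * a))"
    using * assms(3) by (simp add: rotation_generator_def circle_point_def inner_add_left algebra_simps)
  ultimately show ?thesis by simp
qed

text \<open>The generator is linear and skew, so the distance of two solutions is constant.\<close>

lemma rotation_ode_unique:
  assumes "\<And>t. t \<in> {0..1} \<Longrightarrow> (N has_vector_derivative a *\<^sub>R rotation_generator u v (N t)) (at t within {0..1})"
    and "\<And>t. t \<in> {0..1} \<Longrightarrow> (M has_vector_derivative a *\<^sub>R rotation_generator u v (M t)) (at t within {0..1})"
    and "N 0 = M 0"
  shows "N 1 = M (1::real)"
proof -
  define D where "D t = N t - M t" for t
  have D: "(D has_vector_derivative a *\<^sub>R rotation_generator u v (D t)) (at t within {0..1})"
    if "t \<in> {0..1}" for t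
    unfolding D_def
    using has_vector_derivative_diff[OF assms(1,2)[OF that]]
    by (simp add: linear_diff[OF linear_rotation_generator] scaleR_diff_right)
  have "((\<lambda>t. D t \<bullet> D t) has_field_derivative 0) (at t within {0..1})" if "t \<in> {0..1}" for t
    using bounded_bilinear.has_vector_derivative[OF bounded_bilinear_inner D[OF that] D[OF that]]
    by (simp add: has_real_derivative_iff_has_vector_derivative rotation_generator_skew
        inner_commute[of "rotation_generator u v _"])
  then obtain c where "\<And>t. t \<in> {0..1} \<Longrightarrow> D t \<bullet> D t = c"
    using has_field_derivative_zero_constant[of "{0..1}" "\<lambda>t. D t \<bullet> D t"] by auto
  from this[of 0] this[of 1] have "D 1 \<bullet> D 1 = 0" using assms(3) by (simp add: D_def)
  then show ?thesis by (simp add: D_def)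
qed

text \<open>\<open>\<Phi> a x\<close> is the end point at time \<open>1\<close> of the solution of \<open>\<gamma>' = a X(\<gamma>)\<close> starting at \<open>x\<close>, for the lifted field \<open>X\<close> of the rotation
  generator \<open>A\<close>. Since \<open>F \<bullet> dF(X) = l \<parallel>F\<parallel>\<^sup>2\<close> vanishes where \<open>\<parallel>F\<parallel> \<le> \<epsilon>\<close>, a solution that starts in
  \<open>K m = {m \<le> \<parallel>F\<parallel>}\<close> with \<open>m \<le> \<epsilon>\<close> stays there. Hence solutions exist, although \<open>X\<close> is bad near \<open>V(F)\<close>: cut
  \<open>X\<close> off below the level \<open>m\<close>, which makes it a Lipschitz field on all of \<open>W\<close>, and observe that the solution never meets the
  region in which \<open>X\<close> was changed. Continuity follows in the same way from the estimates on \<open>K m\<close>. Finally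
  \<open>F / \<parallel>F\<parallel>\<close> solves the linear equation \<open>N' = a A N\<close> along \<open>\<gamma>\<close>.\<close>

lemma rotation_flow:
  fixes F :: "'a::euclidean_space \<Rightarrow> 'b::euclidean_space"
  assumes W: "compact W" "smooth_submanifold d W" and F: "Ck_on 2 UNIV F"
    and ab: "condition_a W F" "condition_b W F"
    and uv: "norm u = 1" "norm v = 1" "u \<bullet> v = 0"
  obtains \<Phi> :: "real \<Rightarrow> 'a \<Rightarrow> 'a" where
    "continuous_on (UNIV \<times> {x \<in> W. F x \<noteq> 0}) (\<lambda>(a, x). \<Phi> a x)"
    "\<And>x. x \<in> W \<Longrightarrow> F x \<noteq> 0 \<Longrightarrow> \<Phi> 0 x = x"
    "\<And>a x. x \<in> W \<Longrightarrow> F x \<noteq> 0 \<Longrightarrow> \<Phi> a x \<in> W \<and> F (\<Phi> a x) \<noteq> 0"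
    "\<And>a x \<theta>. x \<in> W \<Longrightarrow> F x \<noteq> 0 \<Longrightarrow> normalized F x = circle_point u v \<theta> \<Longrightarrow>
      normalized F (\<Phi> a x) = circle_point u v (\<theta> + a)"
proof -
  have F2: "Ck_on (Suc 1) UNIV F" using F by (simp only: numeral_2_eq_2 One_nat_def)
  then obtain F' where "\<forall>x\<in>UNIV. (F has_derivative F' x) (at x)"
    unfolding Ck_on.simps(2) by blast
  then have F': "\<And>x. (F has_derivative F' x) (at x)" by blast
  define A where "A = rotation_generator u v"
  have linA: "linear A" unfolding A_def by (rule linear_rotation_generator)
  obtain X \<epsilon> where \<epsilon>: "\<epsilon> > 0" and lipX: "\<And>r. r > 0 \<Longrightarrow> lip {x \<in> W. r \<le> norm (F x)} X"
    and XT: "\<And>x. x \<in> W \<Longrightarrow> F x \<noteq> 0 \<Longrightarrow> X x \<in> velocities W x"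
    and XF: "\<And>x. x \<in> W \<Longrightarrow> F x \<noteq> 0 \<Longrightarrow>
      \<exists>l. F' x (X x) = A (F x) + l *\<^sub>R F x \<and> (norm (F x) \<le> \<epsilon> \<longrightarrow> l = 0)"
    by (rule lifted_vector_field[OF W F F' ab linA]) blast
  obtain l where l: "\<And>x. x \<in> W \<Longrightarrow> F x \<noteq> 0 \<Longrightarrow> F' x (X x) = A (F x) + l x *\<^sub>R F x"
      "\<And>x. x \<in> W \<Longrightarrow> F x \<noteq> 0 \<Longrightarrow> norm (F x) \<le> \<epsilon> \<Longrightarrow> l x = 0"
    using XF by metis
  have linF': "linear (F' x)" for x using F' has_derivative_linear by blast
  have contF: "continuous_on S F" for S
    by (intro continuous_at_imp_continuous_on ballI has_derivative_continuous[OF F'])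
  define K where "K m = {x \<in> W. m \<le> norm (F x)}" for m
  have compK: "compact (K m)" for m
  proof -
    have "closed (K m)" unfolding K_def
      using compact_imp_closed[OF W(1)] continuous_on_norm[OF contF]
      by (intro continuous_on_closed_Collect_le) auto
    then have "compact (W \<inter> K m)" by (rule compact_Int_closed[OF W(1)])
    moreover have "W \<inter> K m = K m" by (auto simp: K_def)
    ultimately show ?thesis by (simp only:)
  qed
  \<comment> \<open>The speed \<open>k\<close> is arbitrary, so that this applies to the field cut off
    as well as to \<open>X\<close>.\<close>
  have stays: "\<gamma> t \<in> K m"
    if \<gamma>: "\<gamma> ` {0..1} \<subseteq> W" "\<And>t. t \<in> {0..1} \<Longrightarrow> (\<gamma> has_vector_derivative k t *\<^sub>R X (\<gamma> t)) (at t within {0..1})"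
      and m: "0 < m" "m \<le> \<epsilon>" "m \<le> norm (F (\<gamma> 0))" and t: "t \<in> {0..1}" for \<gamma> k m t
  proof -
    have W\<gamma>: "\<gamma> s \<in> W" if "s \<in> {0..1}" for s using \<gamma>(1) that by blast
    have "m\<^sup>2 \<le> F (\<gamma> t) \<bullet> F (\<gamma> t)"
    proof (rule stays_above_level[of "\<lambda>s. F (\<gamma> s) \<bullet> F (\<gamma> s)" "\<lambda>s. 2 * k s * (F (\<gamma> s) \<bullet> F' (\<gamma> s) (X (\<gamma> s)))", OF _ _ _ t])
      fix s :: real assume s: "s \<in> {0..1}"
      have 1: "((\<lambda>s. F (\<gamma> s)) has_vector_derivative F' (\<gamma> s) (k s *\<^sub>R X (\<gamma> s))) (at s within {0..1})"
        by (rule has_vector_derivative_compose[OF \<gamma>(2)[OF s] F'])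
      show "((\<lambda>s. F (\<gamma> s) \<bullet> F (\<gamma> s)) has_real_derivative
          2 * k s * (F (\<gamma> s) \<bullet> F' (\<gamma> s) (X (\<gamma> s)))) (at s within {0..1})"
        using bounded_bilinear.has_vector_derivative[OF bounded_bilinear_inner 1 1]
        by (simp add: has_real_derivative_iff_has_vector_derivative linear_scale[OF linF'] inner_commute mult_ac)
      assume "F (\<gamma> s) \<bullet> F (\<gamma> s) < m\<^sup>2"
      then have "norm (F (\<gamma> s)) < m"
        using power2_less_imp_less[of "norm (F (\<gamma> s))" m] m(1) by (simp add: dot_square_norm)
      then show "2 * k s * (F (\<gamma> s) \<bullet> F' (\<gamma> s) (X (\<gamma> s))) = 0"
        using l[OF W\<gamma>[OF s]] m(2)
        by (cases "F (\<gamma> s) = 0") (auto simp: A_def rotation_generator_skew)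
    qed (use m in \<open>simp add: dot_square_norm\<close>)
    then have "m \<le> norm (F (\<gamma> t))"
      using power2_le_imp_le[of m "norm (F (\<gamma> t))"] by (simp add: dot_square_norm)
    then show ?thesis using W\<gamma>[OF t] by (simp add: K_def)
  qed
  define sol where "sol a x \<gamma> \<longleftrightarrow> \<gamma> 0 = x \<and> \<gamma> ` {0..1} \<subseteq> W \<and>
    (\<forall>t\<in>{0..1}. (\<gamma> has_vector_derivative a *\<^sub>R X (\<gamma> t)) (at t within {0..1}))" for a x and \<gamma> :: "real \<Rightarrow> 'a"
  have solD: "\<gamma> 0 = x" "\<gamma> ` {0..1} \<subseteq> W"
      "\<And>t. t \<in> {0..1} \<Longrightarrow> (\<gamma> has_vector_derivative a *\<^sub>R X (\<gamma> t)) (at t within {0..1})"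
    if "sol a x \<gamma>" for a x \<gamma>
    using that unfolding sol_def by blast+
  have sol_K: "\<gamma> ` {0..1} \<subseteq> K m" if s: "sol a x \<gamma>" and m: "0 < m" "m \<le> \<epsilon>" "m \<le> norm (F x)" for a x \<gamma> m
    using stays[of \<gamma> "\<lambda>_. a" m] solD[OF s] m by auto
  have sol_ex: "\<exists>\<gamma>. sol a x \<gamma>" if x: "x \<in> W" "F x \<noteq> 0" for a x
  proof -
    define m where "m = min (norm (F x)) \<epsilon>"
    have m: "0 < m" "m \<le> \<epsilon>" "m \<le> norm (F x)" using x \<epsilon> by (auto simp: m_def)
    \<comment> \<open>The factor \<open>a\<close> times a cutoff that is \<open>0\<close> where
      \<open>\<parallel>F\<parallel> \<le> m/2\<close> and \<open>1\<close> where \<open>m \<le>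
      \<parallel>F\<parallel>\<close>.\<close>
    define k where "k y = 2 * a / m * (min m (max (m/2) (norm (F y))) - m/2)" for y
    have k: "k y = 0" if "\<not> m/2 \<le> norm (F y)" for y using that m by (simp add: k_def)
    have k1: "k y = a" if "m \<le> norm (F y)" for y
    proof -
      have "min m (max (m/2) (norm (F y))) = m" using that m(1) by linarith
      then show ?thesis using m(1) by (simp add: k_def)
    qed
    have "lip W (\<lambda>y. k y *\<^sub>R X y)"
    proof (rule lip_scaleR_cutoff[OF W(1), of _ "K (m/2)"])
      have "Ck_on 1 UNIV F" using Ck_on_pred F2 by blast
      then have "lip W F" using C1_lip_compact W(1) by blast
      then have "lip W (\<lambda>y. min m (max (m/2) (norm (F y))) - m/2)"
        by (rule lip_compose_norm[of _ _ "\<lambda>s. min m (max (m/2) s) - m/2"]) linarith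
      then show "lip W k"
        unfolding k_def by (rule lip_linear[OF bounded_linear_mult_right])
      show "compact (K (m/2))" by (rule compK)
      show "lip (K (m/2)) X" using lipX[of "m/2"] m by (simp add: K_def)
    qed (use k in \<open>auto simp: K_def\<close>)
    then obtain L where "L-lipschitz_on W (\<lambda>y. k y *\<^sub>R X y)" by blast
    moreover have "k y *\<^sub>R X y \<in> velocities W y" if "y \<in> W" for y
      using XT[OF that] k[of y] subspace_velocities[OF W(2) that] m(1)
      by (cases "F y = 0") (auto simp: subspace_scale subspace_0)
    ultimately obtain \<gamma> where \<gamma>: "\<gamma> 0 = x" "\<gamma> ` {0..1} \<subseteq> W"
        "\<And>t. t \<in> {0..1} \<Longrightarrow> (\<gamma> has_vector_derivative k (\<gamma> t) *\<^sub>R X (\<gamma> t)) (at t within {0..1})"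
      by (rule lipschitz_ode_solution_in[OF compact_imp_closed[OF W(1)] _ _ x(1)]) blast+
    have "k (\<gamma> t) = a" if "t \<in> {0..1}" for t
      using stays[of \<gamma> "\<lambda>t. k (\<gamma> t)", OF \<gamma>(2,3) m(1,2) _ that] m(3) \<gamma>(1) k1 by (simp add: K_def)
    then show ?thesis using \<gamma> unfolding sol_def by (intro exI[of _ \<gamma>]) auto
  qed
  define flow where "flow a x = (SOME \<gamma>. sol a x \<gamma>)" for a x
  have flow: "sol a x (flow a x)" if "x \<in> W" "F x \<noteq> 0" for a x
    unfolding flow_def by (rule someI_ex[OF sol_ex[OF that]])
  have dependence: "\<exists>L C. \<forall>a b x y \<alpha> \<beta>. x \<in> K m \<longrightarrow> y \<in> K m \<longrightarrow> sol a x \<alpha> \<longrightarrow> sol b y \<beta> \<longrightarrow>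
      (dist (\<alpha> 1) (\<beta> 1))\<^sup>2 \<le> ((dist x y)\<^sup>2 + (\<bar>a - b\<bar> * C)\<^sup>2) * exp (2 * \<bar>a\<bar> * L + 1)"
    if m: "0 < m" "m \<le> \<epsilon>" for m
  proof -
    obtain L where L: "L-lipschitz_on (K m) X" using lipX[OF m(1)] by (auto simp: K_def)
    obtain C where C: "\<And>x. x \<in> K m \<Longrightarrow> norm (X x) \<le> C"
      by (rule lip_bounded[OF compK, of m X]) (use L in blast)+
    have "(dist (\<alpha> 1) (\<beta> 1))\<^sup>2 \<le> ((dist x y)\<^sup>2 + (\<bar>a - b\<bar> * C)\<^sup>2) * exp (2 * \<bar>a\<bar> * L + 1)"
      if "x \<in> K m" "y \<in> K m" and s: "sol a x \<alpha>" "sol b y \<beta>" for a b x y \<alpha> \<beta>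
      using lipschitz_ode_dependence[OF L C sol_K[OF s(1) m] solD(3)[OF s(1)] sol_K[OF s(2) m] solD(3)[OF s(2)]]
        solD(1)[OF s(1)] solD(1)[OF s(2)] that by (simp add: K_def)
    then show ?thesis by blast
  qed
  define \<Phi> where "\<Phi> a x = flow a x 1" for a x
  show thesis
  proof (rule that[of \<Phi>])
    fix a x assume x: "x \<in> W" "F x \<noteq> 0"
    define m where "m = min (norm (F x)) \<epsilon>"
    have m: "0 < m" "m \<le> \<epsilon>" "m \<le> norm (F x)" using x \<epsilon> by (auto simp: m_def)
    have in_K: "flow a x t \<in> K m" if "t \<in> {0..1}" for a t
      using sol_K[OF flow[OF x] m] that by blast
    then have WF: "flow a x t \<in> W" "F (flow a x t) \<noteq> 0" if "t \<in> {0..1}" for a t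
      using in_K[OF that, of a] m(1) by (auto simp: K_def)
    then show "\<Phi> a x \<in> W \<and> F (\<Phi> a x) \<noteq> 0" by (simp add: \<Phi>_def)
    show "\<Phi> 0 x = x"
    proof -
      have "sol 0 x (\<lambda>_. x)" using x by (auto simp: sol_def)
      moreover have "x \<in> K m" using x m by (simp add: K_def)
      moreover obtain L C where "\<forall>a b x y \<alpha> \<beta>. x \<in> K m \<longrightarrow> y \<in> K m \<longrightarrow> sol a x \<alpha> \<longrightarrow> sol b y \<beta> \<longrightarrow>
          (dist (\<alpha> 1) (\<beta> 1))\<^sup>2 \<le> ((dist x y)\<^sup>2 + (\<bar>a - b\<bar> * C)\<^sup>2) * exp (2 * \<bar>a\<bar> * L + 1)"
        using dependence[OF m(1,2)] by blast
      ultimately have "(dist (flow 0 x 1) x)\<^sup>2 \<le> ((dist x x)\<^sup>2 + (\<bar>0 - 0\<bar> * C)\<^sup>2) * exp (2 * \<bar>0\<bar> * L + 1)"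
        using flow[OF x] by blast
      then show ?thesis by (simp add: \<Phi>_def)
    qed
    fix \<theta> assume \<theta>: "normalized F x = circle_point u v \<theta>"
    have "normalized F (flow a x 1) = circle_point u v (\<theta> + 1 * a)"
    proof (rule rotation_ode_unique[where N = "\<lambda>t. normalized F (flow a x t)"])
      show "normalized F (flow a x 0) = circle_point u v (\<theta> + 0 * a)"
        using solD(1)[OF flow[OF x]] \<theta> by simp
      fix t :: real assume t: "t \<in> {0..1}"
      show "((\<lambda>t. circle_point u v (\<theta> + t * a)) has_vector_derivative
          a *\<^sub>R rotation_generator u v (circle_point u v (\<theta> + t * a))) (at t within {0..1})"
        by (rule circle_point_has_derivative[OF uv])
      let ?z = "flow a x t"
      let ?D = "\<lambda>h. (1 / norm (F ?z)) *\<^sub>R F' ?z h - ((F ?z \<bullet> F' ?z h) / norm (F ?z) ^ 3) *\<^sub>R F ?z"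
      have z: "?z \<in> W" "F ?z \<noteq> 0" using WF[OF t] by auto
      have "((\<lambda>t. normalized F (flow a x t)) has_vector_derivative ?D (a *\<^sub>R X ?z)) (at t within {0..1})"
        by (rule has_vector_derivative_compose[OF solD(3)[OF flow[OF x] t] normalized_has_derivative[OF F' z(2)]])
      moreover have "?D (a *\<^sub>R X ?z) = a *\<^sub>R rotation_generator u v (normalized F ?z)"
      proof -
        have e1: "F' ?z (a *\<^sub>R X ?z) = a *\<^sub>R A (F ?z) + (a * l ?z) *\<^sub>R F ?z"
          using l(1)[OF z] by (simp add: linear_scale[OF linF'] scaleR_add_right)
        have e2: "F ?z \<bullet> F' ?z (a *\<^sub>R X ?z) = a * l ?z * (norm (F ?z))\<^sup>2"
          by (simp add: e1 inner_add_right A_def rotation_generator_skew dot_square_norm)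
        have e3: "a * l ?z * (norm (F ?z))\<^sup>2 / norm (F ?z) ^ 3 = a * l ?z / norm (F ?z)"
          using z(2) by (simp add: power2_eq_square power3_eq_cube)
        have e4: "A (normalized F ?z) = (1 / norm (F ?z)) *\<^sub>R A (F ?z)"
          by (simp add: normalized_def linear_scale[OF linA] divide_inverse)
        show ?thesis
          unfolding e2 e3 unfolding e1 A_def[symmetric] e4 by (simp add: algebra_simps)
      qed
      ultimately show "((\<lambda>t. normalized F (flow a x t)) has_vector_derivative
          a *\<^sub>R rotation_generator u v (normalized F ?z)) (at t within {0..1})" by simp
    qed
    then show "normalized F (\<Phi> a x) = circle_point u v (\<theta> + a)" by (simp add: \<Phi>_def)
  next
    show "continuous_on (UNIV \<times> {x \<in> W. F x \<noteq> 0}) (\<lambda>(a, x). \<Phi> a x)"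
      unfolding continuous_on
    proof
      let ?S = "UNIV \<times> {x \<in> W. F x \<noteq> 0}"
      fix z :: "real \<times> 'a" assume z: "z \<in> ?S"
      obtain a0 x0 where z0: "z = (a0, x0)" "x0 \<in> W" "F x0 \<noteq> 0" using z by auto
      \<comment> \<open>Half the norm, so that the points near \<open>x0\<close> belong to \<open>K
        m\<close> too.\<close>
      define m where "m = min (norm (F x0) / 2) \<epsilon>"
      have m: "0 < m" "m \<le> \<epsilon>" "m < norm (F x0)" using z0 \<epsilon> by (auto simp: m_def min_less_iff_disj)
      obtain L C where LC: "\<And>a b x y \<alpha> \<beta>. x \<in> K m \<Longrightarrow> y \<in> K m \<Longrightarrow> sol a x \<alpha> \<Longrightarrow> sol b y \<beta> \<Longrightarrow>
          (dist (\<alpha> 1) (\<beta> 1))\<^sup>2 \<le> ((dist x y)\<^sup>2 + (\<bar>a - b\<bar> * C)\<^sup>2) * exp (2 * \<bar>a\<bar> * L + 1)"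
        using dependence[OF m(1,2)] by blast
      define g where "g = (\<lambda>y. ((dist x0 (snd y))\<^sup>2 + (\<bar>a0 - fst y\<bar> * C)\<^sup>2) * exp (2 * \<bar>a0\<bar> * L + 1))"
      have "((\<lambda>y. sqrt (g y)) \<longlongrightarrow> sqrt (g z)) (at z within ?S)"
        unfolding g_def by (intro tendsto_intros)
      then have lim: "((\<lambda>y. sqrt (g y)) \<longlongrightarrow> 0) (at z within ?S)" by (simp add: g_def z0)
      have "\<forall>\<^sub>F y in at z within ?S. y \<in> ?S"
        by (simp add: eventually_at_filter)
      moreover have "\<forall>\<^sub>F y in at z within ?S. m < norm (F (snd y))"
      proof (rule order_tendstoD(1))
        have "isCont F x0" using F' has_derivative_continuous by blast
        then show "((\<lambda>y. norm (F (snd y))) \<longlongrightarrow> norm (F x0)) (at z within ?S)"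
          using z0 by (intro tendsto_norm isCont_tendsto_compose[of x0 F]) (auto intro!: tendsto_eq_intros)
      qed (use m in simp)
      ultimately have "\<forall>\<^sub>F y in at z within ?S. norm (dist ((\<lambda>(a, x). \<Phi> a x) y) ((\<lambda>(a, x). \<Phi> a x) z)) \<le> sqrt (g y)"
      proof eventually_elim
        case (elim y)
        obtain b y' where y: "y = (b, y')" "y' \<in> W" "F y' \<noteq> 0" using elim(1) by auto
        have "(dist (flow a0 x0 1) (flow b y' 1))\<^sup>2 \<le> g y"
          using LC[of x0 y' a0 "flow a0 x0" b "flow b y'"] flow z0 y elim(2) m by (simp add: K_def g_def)
        then have "dist (\<Phi> a0 x0) (\<Phi> b y') \<le> sqrt (g y)"
          unfolding \<Phi>_def by (rule real_le_rsqrt)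
        then show ?case using y z0 by (simp add: dist_commute)
      qed
      then have "((\<lambda>y. dist ((\<lambda>(a, x). \<Phi> a x) y) ((\<lambda>(a, x). \<Phi> a x) z)) \<longlongrightarrow> 0) (at z within ?S)"
        using lim by (rule Lim_null_comparison)
      then show "((\<lambda>(a, x). \<Phi> a x) \<longlongrightarrow> (\<lambda>(a, x). \<Phi> a x) z) (at z within ?S)"
        by (rule tendsto_dist_iff[THEN iffD2])
    qed
  qed
qed

section \<open>Fibres and half circles\<close>

text \<open>For orthonormal \<open>u\<close> and \<open>v\<close> this is the part of \<open>W\<close> above the open half circle from \<open>-v\<close> through \<open>u\<close> to \<open>v\<close>.\<close>

definition half_circle_sector :: "'a set \<Rightarrow> ('a \<Rightarrow> 'b::real_inner) \<Rightarrow> 'b \<Rightarrow> 'b \<Rightarrow> 'a set" where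
  "half_circle_sector W F u v = {x \<in> W. \<exists>\<alpha> \<beta>. \<alpha> > 0 \<and> F x = \<alpha> *\<^sub>R u + \<beta> *\<^sub>R v}"

text \<open>Let \<open>\<theta> x\<close> be the angle of \<open>F x\<close>. Rotating \<open>x\<close> by the angle \<open>s (t - \<theta> x)\<close>, \<open>0 \<le> s \<le> 1\<close>, moves it into the fibre at
  angle \<open>t\<close> without leaving the half circle, and does not move the points of that fibre.\<close>

lemma sector_homotopy_eqv_fibre:
  fixes F :: "'a::euclidean_space \<Rightarrow> 'b::euclidean_space"
  assumes W: "compact W" "smooth_submanifold d W" and F: "Ck_on 2 UNIV F"
    and ab: "condition_a W F" "condition_b W F"
    and uv: "norm u = 1" "norm v = 1" "u \<bullet> v = 0"
    and t: "- (pi/2) < t" "t < pi/2"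
  shows "half_circle_sector W F u v homotopy_eqv normalized_fibre W F (circle_point u v t)"
proof -
  let ?E = "half_circle_sector W F u v" and ?M = "normalized_fibre W F (circle_point u v t)"
  obtain \<Phi> :: "real \<Rightarrow> 'a \<Rightarrow> 'a" where
    cont: "continuous_on (UNIV \<times> {x \<in> W. F x \<noteq> 0}) (\<lambda>(a, x). \<Phi> a x)"
    and \<Phi>0: "\<And>x. x \<in> W \<Longrightarrow> F x \<noteq> 0 \<Longrightarrow> \<Phi> 0 x = x"
    and \<Phi>W: "\<And>a x. x \<in> W \<Longrightarrow> F x \<noteq> 0 \<Longrightarrow> \<Phi> a x \<in> W \<and> F (\<Phi> a x) \<noteq> 0"
    and rot: "\<And>a x \<theta>. x \<in> W \<Longrightarrow> F x \<noteq> 0 \<Longrightarrow> normalized F x = circle_point u v \<theta> \<Longrightarrow>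
      normalized F (\<Phi> a x) = circle_point u v (\<theta> + a)"
    by (rule rotation_flow[OF W F ab uv]) blast
  have inner: "u \<bullet> u = 1" "v \<bullet> v = 1" "v \<bullet> u = 0"
    using uv by (simp_all add: dot_square_norm inner_commute)
  have contF: "continuous_on S F" for S
  proof -
    have "Ck_on (Suc 1) UNIV F" using F by (simp only: numeral_2_eq_2 One_nat_def)
    then have "Ck_on 0 UNIV F" using Ck_on_pred by (metis One_nat_def)
    then show ?thesis using continuous_on_subset by auto
  qed
  have normF: "F x = norm (F x) *\<^sub>R normalized F x" if "F x \<noteq> 0" for x
    using that by (simp add: normalized_def)
  define \<theta> where "\<theta> x = arctan ((F x \<bullet> v) / (F x \<bullet> u))" for x
  have E: "x \<in> W" "F x \<noteq> 0" "F x \<bullet> u > 0" "normalized F x = circle_point u v (\<theta> x)" if xE: "x \<in> ?E" for x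
  proof -
    obtain \<alpha> \<beta> where \<alpha>\<beta>: "x \<in> W" "\<alpha> > 0" "F x = \<alpha> *\<^sub>R u + \<beta> *\<^sub>R v"
      using xE by (auto simp: half_circle_sector_def)
    have in': "F x \<bullet> u = \<alpha>" "F x \<bullet> v = \<beta>"
      unfolding \<alpha>\<beta>(3) using inner uv(3) by (simp_all add: inner_add_left)
    then show "x \<in> W" "F x \<noteq> 0" "F x \<bullet> u > 0" using \<alpha>\<beta> by auto
    define q where "q = sqrt (1 + (\<beta>/\<alpha>)\<^sup>2)"
    have q: "q > 0" unfolding q_def by (simp add: add_pos_nonneg)
    have "cos (\<theta> x) = 1 / q" "sin (\<theta> x) = (\<beta>/\<alpha>) / q"
      by (simp_all add: \<theta>_def in' q_def cos_arctan sin_arctan)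
    then have Fx: "F x = (\<alpha> * q) *\<^sub>R circle_point u v (\<theta> x)"
      using q \<alpha>\<beta>(2) by (simp add: \<alpha>\<beta>(3) circle_point_def scaleR_add_right)
    then have "norm (F x) = \<alpha> * q" using q \<alpha>\<beta>(2) norm_circle_point[OF uv] by simp
    then have "normalized F x = inverse (\<alpha> * q) *\<^sub>R (\<alpha> * q) *\<^sub>R circle_point u v (\<theta> x)"
      by (simp only: normalized_def Fx[symmetric])
    also have "\<dots> = circle_point u v (\<theta> x)"
    proof -
      have "inverse (\<alpha> * q) * (\<alpha> * q) = 1" using q \<alpha>\<beta>(2) by (intro left_inverse) simp
      then show ?thesis by (simp only: scaleR_scaleR scaleR_one)
    qed
    finally show "normalized F x = circle_point u v (\<theta> x)" .
  qed
  have inE: "x \<in> ?E" if "x \<in> W" "F x \<noteq> 0" "normalized F x = circle_point u v s" "\<bar>s\<bar> < pi/2" for x s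
  proof -
    have "F x = (norm (F x) * cos s) *\<^sub>R u + (norm (F x) * sin s) *\<^sub>R v"
      using normF[OF that(2)] that(3) by (simp add: circle_point_def scaleR_add_right)
    moreover have "norm (F x) * cos s > 0"
      using that by (intro mult_pos_pos cos_gt_zero_pi) auto
    ultimately show ?thesis using that(1) by (auto simp: half_circle_sector_def)
  qed
  have \<theta>_range: "\<bar>\<theta> x\<bar> < pi/2" for x
    using arctan_bounded[of "(F x \<bullet> v) / (F x \<bullet> u)"] unfolding \<theta>_def by linarith
  have ME: "?M \<subseteq> ?E"
    using inE t by (force simp: normalized_fibre_def zeros_in_def)
  have \<theta>M: "\<theta> x = t" if "x \<in> ?M" for x
  proof -
    have x: "F x \<noteq> 0" "F x = norm (F x) *\<^sub>R circle_point u v t"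
      using that normF[of x] by (auto simp: normalized_fibre_def zeros_in_def)
    have "F x \<bullet> v = norm (F x) * sin t" "F x \<bullet> u = norm (F x) * cos t"
      by (subst x(2), simp add: circle_point_def inner_add_left inner uv(3))+
    then have "(F x \<bullet> v) / (F x \<bullet> u) = tan t" using x(1) by (simp add: tan_def)
    then show ?thesis using t by (simp add: \<theta>_def arctan_tan)
  qed
  define h where "h s x = \<Phi> (s * (t - \<theta> x)) x" for s x
  have h: "h s x \<in> W" "F (h s x) \<noteq> 0" "normalized F (h s x) = circle_point u v (\<theta> x + s * (t - \<theta> x))"
    if "x \<in> ?E" for s x
    using \<Phi>W[OF E(1,2)[OF that]] rot[OF E(1,2,4)[OF that]] by (auto simp: h_def)
  have cont\<theta>: "continuous_on ?E \<theta>"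
    unfolding \<theta>_def using E(3) by (intro continuous_intros contF) force
  have "continuous_on ({0..1} \<times> ?E) (\<lambda>z. (\<lambda>(a, x). \<Phi> a x) (fst z * (t - \<theta> (snd z)), snd z))"
  proof (rule continuous_on_compose2[OF cont])
    show "continuous_on ({0..1} \<times> ?E) (\<lambda>z. (fst z * (t - \<theta> (snd z)), snd z))"
      by (intro continuous_intros continuous_on_compose2[OF cont\<theta>]) auto
  qed (use E(1,2) in auto)
  then have conth: "continuous_on ({0..1} \<times> ?E) (\<lambda>z. h (fst z) (snd z))" by (simp add: h_def)
  have "h s x \<in> ?E" if x: "x \<in> ?E" and s: "s \<in> {0..1}" for s x
  proof (rule inE[OF h[OF x]])
    have "(1 - s) * \<bar>\<theta> x\<bar> \<le> (1 - s) * max \<bar>\<theta> x\<bar> \<bar>t\<bar>" "s * \<bar>t\<bar> \<le> s * max \<bar>\<theta> x\<bar> \<bar>t\<bar>"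
      using s by (auto intro!: mult_left_mono)
    moreover have "\<bar>\<theta> x + s * (t - \<theta> x)\<bar> \<le> (1 - s) * \<bar>\<theta> x\<bar> + s * \<bar>t\<bar>"
    proof -
      have "\<theta> x + s * (t - \<theta> x) = (1 - s) * \<theta> x + s * t" by (simp add: algebra_simps)
      then show ?thesis using s abs_triangle_ineq[of "(1 - s) * \<theta> x" "s * t"] by (simp add: abs_mult)
    qed
    ultimately have "\<bar>\<theta> x + s * (t - \<theta> x)\<bar> \<le> max \<bar>\<theta> x\<bar> \<bar>t\<bar>" by (simp add: algebra_simps)
    then show "\<bar>\<theta> x + s * (t - \<theta> x)\<bar> < pi/2" using \<theta>_range[of x] t by linarith
  qed
  moreover have "h 0 x = id x" if "x \<in> ?E" for x using \<Phi>0[OF E(1,2)[OF that]] by (simp add: h_def)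
  ultimately have "homotopic_with_canon (\<lambda>x. True) ?E ?E id (h 1)"
    using conth by (subst homotopic_with)
      (auto intro!: exI[of _ "\<lambda>z. h (fst z) (snd z)"] simp: image_subset_iff)
  moreover have "retraction ?E ?M (h 1)"
    unfolding retraction_def
  proof (intro conjI ME funcsetI ballI)
    show "continuous_on ?E (h 1)"
    proof -
      have "continuous_on ?E (\<lambda>x. (1 :: real, x))" "(\<lambda>x. (1 :: real, x)) ` ?E \<subseteq> {0..1} \<times> ?E"
        by (auto intro!: continuous_intros)
      from continuous_on_compose2[OF conth this] show ?thesis by simp
    qed
    show "h 1 x \<in> ?M" if "x \<in> ?E" for x
      using h[OF that, of 1] by (simp add: normalized_fibre_def zeros_in_def)
    show "h 1 x = x" if "x \<in> ?M" for x
      using \<theta>M[OF that] \<Phi>0 E(1,2) ME that by (auto simp: h_def)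
  qed
  ultimately show ?thesis by (rule deformation_retract_imp_homotopy_eqv)
qed

text \<open>The half circle centred at the midpoint direction \<open>u\<close> of \<open>y\<close> and \<open>y'\<close> contains \<open>y\<close> and \<open>y'\<close>, at angles \<open>t\<close> and \<open>-t\<close>.\<close>

lemma fibres_homotopy_eqv_nonantipodal:
  fixes F :: "'a::euclidean_space \<Rightarrow> 'b::euclidean_space"
  assumes W: "compact W" "smooth_submanifold d W" and F: "Ck_on 2 UNIV F"
    and ab: "condition_a W F" "condition_b W F"
    and y: "norm y = 1" "norm y' = 1" "y' \<noteq> - y"
  shows "normalized_fibre W F y homotopy_eqv normalized_fibre W F y'"
proof (cases "y = y'")
  case True
  then show ?thesis by (simp add: homotopy_equivalent_space_refl)
next
  case False
  define a where "a = norm (y + y') / 2"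
  define b where "b = norm (y - y') / 2"
  have ab0: "a > 0" "b > 0" using y(3) False by (auto simp: a_def b_def eq_neg_iff_add_eq_0 add.commute)
  define u where "u = (y + y') /\<^sub>R norm (y + y')"
  define v where "v = (y - y') /\<^sub>R norm (y - y')"
  have nz: "norm (y + y') \<noteq> 0" "norm (y - y') \<noteq> 0" using ab0 by (auto simp: a_def b_def)
  have yy: "y \<bullet> y = 1" "y' \<bullet> y' = 1" using y by (simp_all add: dot_square_norm)
  have "(y + y') \<bullet> (y - y') = 0"
    using yy by (simp add: inner_add_left inner_diff_right inner_commute[of y' y])
  then have uv: "norm u = 1" "norm v = 1" "u \<bullet> v = 0" using nz by (auto simp: u_def v_def)
  have au: "a *\<^sub>R u = (1/2) *\<^sub>R (y + y')" and bv: "b *\<^sub>R v = (1/2) *\<^sub>R (y - y')"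
    using nz by (simp_all add: a_def b_def u_def v_def)
  have y_eq: "y = a *\<^sub>R u + b *\<^sub>R v" and y'_eq: "y' = a *\<^sub>R u - b *\<^sub>R v"
    unfolding au bv by (simp_all add: algebra_simps flip: scaleR_add_left)
  have "a\<^sup>2 + b\<^sup>2 = 1"
  proof -
    have "a\<^sup>2 = (y + y') \<bullet> (y + y') / 4" "b\<^sup>2 = (y - y') \<bullet> (y - y') / 4"
      by (simp_all add: a_def b_def power_divide power2_norm_eq_inner)
    then show ?thesis
      using yy by (simp add: inner_add_left inner_add_right inner_diff_left inner_diff_right)
  qed
  then have b1: "b < 1" and a_eq: "a = sqrt (1 - b\<^sup>2)"
    using ab0 by (smt (verit) one_le_power zero_less_power, simp add: real_sqrt_unique flip: \<open>a\<^sup>2 + b\<^sup>2 = 1\<close>)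
  define t where "t = arcsin b"
  have t: "- (pi/2) < t" "t < pi/2" using arcsin_lt_bounded[of b] ab0 b1 by (auto simp: t_def)
  have "sin t = b" "cos t = a" using ab0 b1 by (simp_all add: t_def cos_arcsin a_eq)
  then have "y = circle_point u v t" "y' = circle_point u v (- t)"
    using y_eq y'_eq by (simp_all add: circle_point_def)
  moreover have "half_circle_sector W F u v homotopy_eqv normalized_fibre W F (circle_point u v t)"
    by (rule sector_homotopy_eqv_fibre[OF W F ab uv t])
  moreover have "half_circle_sector W F u v homotopy_eqv normalized_fibre W F (circle_point u v (- t))"
    by (rule sector_homotopy_eqv_fibre[OF W F ab uv]) (use t in auto)
  ultimately show ?thesis
    using homotopy_equivalent_space_sym homotopy_eqv_trans by metis
qed

lemma fibres_homotopy_eqv: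
  fixes F :: "'a::euclidean_space \<Rightarrow> 'b::euclidean_space"
  assumes W: "compact W" "smooth_submanifold d W" and F: "Ck_on 2 UNIV F"
    and ab: "condition_a W F" "condition_b W F"
    and dim: "2 \<le> DIM('b)" and y: "norm y = 1" "norm y' = 1"
  shows "normalized_fibre W F y homotopy_eqv normalized_fibre W F y'"
proof (cases "y' = - y")
  case False
  then show ?thesis using fibres_homotopy_eqv_nonantipodal[OF W F ab y] by blast
next
  case True
  \<comment> \<open>A direction orthogonal to \<open>y\<close> is antipodal to neither
    \<open>y\<close> nor \<open>-y\<close>.\<close>
  obtain w' where w': "w' \<noteq> 0" "orthogonal y w'" using orthogonal_to_vector_exists[OF dim] .
  define w where "w = sgn w'"
  have w: "norm w = 1" "y \<bullet> w = 0"
    using w' by (simp_all add: w_def norm_sgn orthogonal_def sgn_div_norm)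
  have "w \<noteq> - y" "y' \<noteq> - w" using w y True by (auto simp: dot_square_norm)
  then have "normalized_fibre W F y homotopy_eqv normalized_fibre W F w"
      "normalized_fibre W F w homotopy_eqv normalized_fibre W F y'"
    using fibres_homotopy_eqv_nonantipodal[OF W F ab] y w(1) by blast+
  then show ?thesis by (rule homotopy_eqv_trans)
qed

text \<open>Here \<open>v\<close> is the coordinate vector of the coordinate of \<open>F\<close> that \<open>G\<close> omits, and \<open>u\<close> is \<open>z\<close> padded with a zero in that
  coordinate. The index map \<open>g\<close> matches the remaining coordinates of \<open>F\<close> with those of \<open>G\<close>.\<close>

lemma normalized_fibre_drop_coordinate:
  fixes f :: "nat \<Rightarrow> 'a::euclidean_space \<Rightarrow> real" and idxF :: "'p::finite \<Rightarrow> nat" and idxG :: "'q::finite \<Rightarrow> nat"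
  assumes p: "1 \<le> p" and idxF: "bij_betw idxF UNIV {1..p}" and F: "F = (\<lambda>x. \<chi> i. f (idxF i) x)"
    and idxG: "bij_betw idxG UNIV {1..p - 1}" and G: "G = (\<lambda>x. \<chi> i. f (idxG i) x)"
    and z: "norm (z :: real ^ 'q) = 1"
  obtains u v :: "real ^ 'p" where "norm u = 1" "norm v = 1" "u \<bullet> v = 0"
    "normalized_fibre W G z = half_circle_sector W F u v"
proof -
  have injF: "inj idxF" and imF: "range idxF = {1..p}" and injG: "inj idxG" and imG: "range idxG = {1..p - 1}"
    using idxF idxG by (auto simp: bij_betw_def)
  obtain i0 where i0: "idxF i0 = p" using imF p by (metis atLeastAtMost_iff imageE order_refl)
  define g where "g i = inv idxG (idxF i)" for i
  have g: "idxG (g i) = idxF i" if "i \<noteq> i0" for i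
  proof -
    have "idxF i \<in> {1..p}" "idxF i \<noteq> p" using imF that i0 injF by (auto simp: inj_eq)
    then have "idxF i \<in> range idxG" by (auto simp: imG)
    then show ?thesis unfolding g_def by (rule f_inv_into_f)
  qed
  have g_onto: "\<exists>i. i \<noteq> i0 \<and> idxF i = idxG j \<and> g i = j" for j
  proof -
    have j: "idxG j \<in> {1..p - 1}" using imG by blast
    then have "idxG j \<in> range idxF" by (auto simp: imF)
    then obtain i where "idxF i = idxG j" by (metis imageE)
    moreover from this have "i \<noteq> i0" using j i0 p by auto
    moreover have "g i = j" using calculation(1) injG by (simp add: g_def)
    ultimately show ?thesis by blast
  qed
  have bij: "bij_betw g (UNIV - {i0}) UNIV"
    unfolding bij_betw_def
  proof
    show "inj_on g (UNIV - {i0})" using g injF by (intro inj_onI) (metis DiffE insertI1 injD)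
    show "g ` (UNIV - {i0}) = UNIV" using g_onto by (metis (no_types, lifting) DiffI UNIV_I UNIV_eq_I image_eqI singletonD)
  qed
  define u :: "real ^ 'p" where "u = (\<chi> i. if i = i0 then 0 else z $ g i)"
  define v :: "real ^ 'p" where "v = axis i0 1"
  have "u \<bullet> u = (\<Sum>i\<in>UNIV - {i0}. z $ g i * z $ g i)"
    unfolding inner_vec_def by (rule sum.mono_neutral_cong_right) (auto simp: u_def)
  also have "\<dots> = z \<bullet> z"
    unfolding inner_vec_def using sum.reindex_bij_betw[OF bij, of "\<lambda>j. z $ j * z $ j"] by simp
  finally have "norm u = 1" using z by (simp add: norm_eq_sqrt_inner)
  moreover have "norm v = 1" by (simp add: v_def norm_axis_1)
  moreover have "u \<bullet> v = 0" by (simp add: v_def inner_axis u_def)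
  moreover have "normalized_fibre W G z = half_circle_sector W F u v"
  proof (intro equalityI subsetI)
    fix x assume "x \<in> normalized_fibre W G z"
    then have x: "x \<in> W" "G x \<noteq> 0" "G x = norm (G x) *\<^sub>R z"
      by (auto simp: normalized_fibre_def zeros_in_def normalized_def)
    have "F x $ i = (norm (G x) *\<^sub>R u + f p x *\<^sub>R v) $ i" for i
    proof (cases "i = i0")
      case True
      then show ?thesis by (simp add: F u_def v_def i0 axis_def)
    next
      case False
      have "F x $ i = G x $ g i" using g[OF False] by (simp add: F G)
      also have "\<dots> = (norm (G x) *\<^sub>R z) $ g i" using x(3) by simp
      finally show ?thesis using False by (simp add: u_def v_def axis_def)
    qed
    then have "F x = norm (G x) *\<^sub>R u + f p x *\<^sub>R v" by (simp add: vec_eq_iff)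
    moreover have "norm (G x) > 0" using x(2) by simp
    ultimately show "x \<in> half_circle_sector W F u v"
      using x(1) unfolding half_circle_sector_def by blast
  next
    fix x assume "x \<in> half_circle_sector W F u v"
    then obtain \<alpha> \<beta> where x: "x \<in> W" "\<alpha> > 0" "F x = \<alpha> *\<^sub>R u + \<beta> *\<^sub>R v"
      by (auto simp: half_circle_sector_def)
    have "G x $ j = (\<alpha> *\<^sub>R z) $ j" for j
    proof -
      obtain i where i: "i \<noteq> i0" "idxF i = idxG j" "g i = j" using g_onto by blast
      have "G x $ j = F x $ i" by (simp add: F G i)
      also have "\<dots> = \<alpha> * z $ j" unfolding x(3) using i by (simp add: u_def v_def axis_def)
      finally show ?thesis by simp
    qed
    then have Gx: "G x = \<alpha> *\<^sub>R z" by (simp add: vec_eq_iff)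
    then show "x \<in> normalized_fibre W G z"
      using x z by (auto simp: normalized_fibre_def zeros_in_def normalized_def)
  qed
  ultimately show thesis using that by blast
qed

theorem theorem3p6:
  fixes p n :: nat
    and W :: "(real ^ 'N) set"
    and f :: "nat \<Rightarrow> real ^ 'N \<Rightarrow> real"
    and idxF :: "'p::finite \<Rightarrow> nat" and F :: "real ^ 'N \<Rightarrow> real ^ 'p"
    and idxG :: "'q::finite \<Rightarrow> nat" and G :: "real ^ 'N \<Rightarrow> real ^ 'q"
    and y :: "real ^ 'p" and z :: "real ^ 'q"
  assumes "3 \<le> p" and "p \<le> n - 1"
    and "compact W" and "semialgebraic W" and "smooth_submanifold (n - 1) W"
    and "bij_betw idxF UNIV {1..p}" and "F = (\<lambda>x. \<chi> i. f (idxF i) x)"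
    and "bij_betw idxG UNIV {1..p - 1}" and "G = (\<lambda>x. \<chi> i. f (idxG i) x)"
    and "Ck_on 2 UNIV F" and "semialgebraic_map F"
    and "condition_a W F" and "condition_b W F"
    and "y \<in> sphere 0 1" and "z \<in> sphere 0 1"
  shows "normalized_fibre W G z homotopy_eqv normalized_fibre W F y"
proof -
  note W = assms(3,5) and F = assms(10) and ab = assms(12,13)
  have "1 \<le> p" "norm z = 1" using assms(1,15) by auto
  then obtain u v :: "real ^ 'p" where uv: "norm u = 1" "norm v = 1" "u \<bullet> v = 0"
      and sector: "normalized_fibre W G z = half_circle_sector W F u v"
    by (rule normalized_fibre_drop_coordinate[OF _ assms(6,7,8,9)])
  have "CARD('p) = p" using bij_betw_same_card[OF assms(6)] by simp
  then have dim: "2 \<le> DIM(real ^ 'p)" using assms(1) by simp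
  have "half_circle_sector W F u v homotopy_eqv normalized_fibre W F (circle_point u v 0)"
    by (rule sector_homotopy_eqv_fibre[OF W F ab uv]) auto
  then have "normalized_fibre W G z homotopy_eqv normalized_fibre W F u"
    by (simp add: sector circle_point_def)
  moreover have "normalized_fibre W F u homotopy_eqv normalized_fibre W F y"
    using assms(14) by (intro fibres_homotopy_eqv[OF W F ab dim uv(1)]) simp
  ultimately show ?thesis by (rule homotopy_eqv_trans)
qed

end
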